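(* Let $p$ be a prime, $q\in\mathbb{C}_p$ with $|q-1|_p<p^{-\frac{1}{p-1}}$, $\lambda\in\mathbb{C}_p\setminus\{0\}$, $r\in\mathbb{N}$, and $x\in\mathbb{Z}_p$. For every integer $n\ge0$, \[ \beta_{n,q}^{(r)}(x)=\sum_{m=0}^n\lambda^{n-m}S_2(n,m)\beta_{m,q}^{(r)}(x|\lambda). \]
   Context: $q^x=\exp(x\log q)$, $[x]_q=\frac{1-q^x}{1-q}$. The $p$-adic $q$-integral of a uniformly differentiable $f$ on $\mathbb{Z}_p$ is $\int_{\mathbb{Z}_p}f(y)\,d\mu_q(y)=\lim_{N\to\infty}\frac{1}{[p^N]_q}\sum_{y=0}^{p^N-1}f(y)q^y$. The Carlitz $q$-Bernoulli polynomials of order $r$ are $\beta_{n,q}^{(r)}(x)=\int_{\mathbb{Z}_p}\cdots\int_{\mathbb{Z}_p}[x_1+\cdots+x_r+x]_q^n\,d\mu_q(x_1)\cdots d\mu_q(x_r)$. For $t\in\mathbb{C}_p$ with $|\lambda t|_p<p^{-1/(p-1)}$, $(1+\lambda t)^{a/\lambda}=\exp(\frac{a}{\lambda}\log(1+\lambda t))$, and the degenerate Carlitz $q$-Bernoulli polynomials of order $r$ are defined by $\int_{\mathbb{Z}_p}\cdots\int_{\mathbb{Z}_p}(1+\lambda t)^{\frac{1}{\lambda}[x_1+\cdots+x_r+x]_q}\,d\mu_q(x_1)\cdots d\mu_q(x_r)=\sum_{n\ge0}\beta_{n,q}^{(r)}(x|\lambda)\frac{t^n}{n!}$. $S_2(n,m)$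 are the Stirling numbers of the second kind: $\frac{(e^t-1)^m}{m!}=\sum_{n\ge m}S_2(n,m)\frac{t^n}{n!}$. *)

theory Defs
  imports
    "HOL-Analysis.Elementary_Metric_Spaces"
    "HOL-Computational_Algebra.Computational_Algebra"
    "HOL-Combinatorics.Stirling"
begin

section \<open>The field of $p$-adic complex numbers\<close>

text \<open>
  The absolute value of \<open>x\<close> is \<open>dist x 0\<close>, so that limits, series and closures are the
  library ones for the metric topology.
\<close>

class complete_valued_field = field_char_0 + complete_space +
  assumes dist_add_right: "dist (x + z) (y + z) = dist x y"
    and dist_mult_zero: "dist (x * y) 0 = dist x 0 * dist y 0"
    and dist_ultrametric: "dist x z \<le> max (dist x y) (dist y z)"

definition vabs :: "'a::complete_valued_field \<Rightarrow> real" where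
  "vabs x = dist x 0"

text \<open>
  In a complete field whose absolute value restricts to the $p$-adic one on the rationals, the
  closure of the rationals is their completion $\mathbb{Q}_p$.
\<close>

definition padic_rats :: "'a::complete_valued_field set" where
  "padic_rats = closure \<rat>"

definition padic_ints :: "'a::complete_valued_field set" where
  "padic_ints = {x \<in> padic_rats. vabs x \<le> 1}"

definition padic_algebraics :: "'a::complete_valued_field set" where
  "padic_algebraics =
     {z. \<exists>f. f \<noteq> 0 \<and> (\<forall>i. coeff f i \<in> padic_rats) \<and> poly f z = 0}"

text \<open>
  \<open>is_padic_complex TYPE('a) p\<close> says that \<open>'a\<close> is (a copy of) $\mathbb{C}_p$, the completion of an
  algebraic closure of $\mathbb{Q}_p$: the absolute value extends the $p$-adic one (normalised by
  $|p|_p = 1/p$; the values on integers determine those on rationals), the elements algebraic over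
  $\mathbb{Q}_p$ form an algebraically closed field, and they are dense in the complete field \<open>'a\<close>.
\<close>

definition is_padic_complex :: "'a::complete_valued_field itself \<Rightarrow> nat \<Rightarrow> bool" where
  "is_padic_complex _ p \<longleftrightarrow>
     (\<forall>k::int. k \<noteq> 0 \<longrightarrow> vabs (of_int k :: 'a) = (1 / real p) ^ multiplicity (int p) k) \<and>
     (\<forall>f :: 'a poly. degree f > 0 \<and> (\<forall>i. coeff f i \<in> padic_algebraics) \<longrightarrow>
        (\<exists>z \<in> padic_algebraics. poly f z = 0)) \<and>
     closure (padic_algebraics :: 'a set) = UNIV"

section \<open>Exponential, logarithm and $q$-numbers\<close>

definition vexp :: "'a::complete_valued_field \<Rightarrow> 'a" where
  "vexp z = (\<Sum>n. z ^ n / fact n)"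

definition vlog :: "'a::complete_valued_field \<Rightarrow> 'a" where
  "vlog z = (\<Sum>n. (-1) ^ n * (z - 1) ^ Suc n / of_nat (Suc n))"

definition qpow :: "'a::complete_valued_field \<Rightarrow> 'a \<Rightarrow> 'a" where
  "qpow q x = vexp (x * vlog q)"

text \<open>For $q = 1$ the quotient is read as its limit, $[x]_1 = x$.\<close>

definition qnum :: "'a::complete_valued_field \<Rightarrow> 'a \<Rightarrow> 'a" where
  "qnum q x = (if q = 1 then x else (1 - qpow q x) / (1 - q))"

section \<open>The $p$-adic $q$-integral\<close>

definition q_integral ::
  "nat \<Rightarrow> 'a::complete_valued_field \<Rightarrow> ('a \<Rightarrow> 'a) \<Rightarrow> 'a" where
  "q_integral p q f =
     lim (\<lambda>N. 1 / qnum q (of_nat (p ^ N)) * (\<Sum>y<p ^ N. f (of_nat y) * q ^ y))"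

text \<open>
  The list argument of the integrand is $[x_1, \dots, x_r]$; the integral in $x_r$ is outermost.
\<close>

primrec multi_q_integral ::
  "nat \<Rightarrow> 'a::complete_valued_field \<Rightarrow> nat \<Rightarrow> ('a list \<Rightarrow> 'a) \<Rightarrow> 'a" where
  "multi_q_integral p q 0 F = F []"
| "multi_q_integral p q (Suc r) F =
     q_integral p q (\<lambda>y. multi_q_integral p q r (\<lambda>ys. F (ys @ [y])))"

section \<open>Carlitz $q$-Bernoulli polynomials and their degenerate version\<close>

definition carlitz_bernoulli ::
  "nat \<Rightarrow> 'a::complete_valued_field \<Rightarrow> nat \<Rightarrow> nat \<Rightarrow> 'a \<Rightarrow> 'a" where
  "carlitz_bernoulli p q r n x = multi_q_integral p q r (\<lambda>ys. qnum q (sum_list ys + x) ^ n)"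

definition conv_radius_exp :: "nat \<Rightarrow> real" where
  "conv_radius_exp p = real p powr (- 1 / (real p - 1))"

text \<open>$(1 + \lambda t)^{a/\lambda}$\<close>

definition degenerate_exp :: "'a::complete_valued_field \<Rightarrow> 'a \<Rightarrow> 'a \<Rightarrow> 'a" where
  "degenerate_exp lam t a = vexp (a / lam * vlog (1 + lam * t))"

text \<open>
  The coefficient sequence determined by the generating function. The integrand is
  $\exp(\frac{a}{\lambda}\log(1+\lambda t))$ with $|a|_p \le 1$, and
  $|\frac{1}{\lambda}\log(1+\lambda t)|_p = |t|_p$ when $|\lambda t|_p < p^{-1/(p-1)}$. For
  $|\lambda|_p < 1$ this condition alone does not make the exponential converge (for instance when
  $|a|_p = 1$), hence the second condition on \<open>t\<close>; for $|\lambda|_p \ge 1$ it is automatic.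
\<close>

definition degenerate_carlitz_bernoulli ::
  "nat \<Rightarrow> 'a::complete_valued_field \<Rightarrow> nat \<Rightarrow> nat \<Rightarrow> 'a \<Rightarrow> 'a \<Rightarrow> 'a" where
  "degenerate_carlitz_bernoulli p q r n x lam =
     (THE b :: nat \<Rightarrow> 'a. \<forall>t.
        vabs (lam * t) < conv_radius_exp p \<and> vabs t < conv_radius_exp p \<longrightarrow>
        (\<lambda>m. b m * t ^ m / fact m) sums
          multi_q_integral p q r (\<lambda>ys. degenerate_exp lam t (qnum q (sum_list ys + x)))) n"

end

(*
  Everything rests on the q-numbers [n] = 1 + q + ... + q^(n-1). The averages
  [p^N]^(-1) sum_(y < p^N) [y]^j q^y are bounded by p uniformly in N and j, and converge because
  [p^N]^(j+1) telescopes into them. Since [y + x] = [x] + [y] (1 + (q - 1) [x]), the q-integral maps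
  polynomials in [x] to polynomials in [x] and enlarges coefficients by at most the factor p. Hence
  beta_k is bounded by p^r uniformly in k, and iterated integrals commute with power series in
  [x_1 + ... + x_r + x] whose coefficients tend to 0.

  Applied to exp(a u) with u = log(1 + lambda t)/lambda this gives
  sum_k beta_k u^k/k! for the generating function. As u^k/k! is the exponential generating function
  of the coefficients of a^k in a (a - lambda) ... (a - (m-1) lambda), exchanging summations shows
  that the degenerate numbers are the images of these falling factorials under a^k |-> beta_k, and
  the theorem is the image of the expansion of a^n in falling factorials.
*)

theory Submission
  imports Defs
begin

section \<open>Ultrametric series\<close>

text \<open>The uniform bound on the averages needs an argument of its own. Solving the telescoped
  identity for the j-th average divides by [j+1], which may be p-adically small: this recursion
  yields the limits, but only bounds that worsen with j. Comparing the averages at levels p^N and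
  p^(N+1) gives a bound free of j, and this is what lets limits pass through series of whose
  coefficients only convergence to 0 is used. The radius p^(-1/(p-1)) enters twice: through the size
  of n! it governs the convergence of exp, and it is the threshold below which p dominates the other
  terms of [p] = ((1+z)^p - 1)/z with z = q - 1, so that |[p^N]| = p^(-N) exactly.\<close>

instance complete_valued_field \<subseteq> topological_ab_group_add
proof
  show "LIM x (nhds a \<times>\<^sub>F nhds b). fst x + snd x :> nhds (a + b)" for a b :: 'a
  proof (rule metric_tendsto_imp_tendsto[OF _ eventuallyI])
    fix x :: "'a \<times> 'a"
    have "dist (fst x + snd x) (a + b) \<le> dist (fst x + snd x) (a + snd x) + dist (a + snd x) (a + b)"
      by (rule dist_triangle)
    also have "dist (a + snd x) (a + b) = dist (snd x) b"
      by (metis add.commute dist_add_right)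
    finally have "dist (fst x + snd x) (a + b) \<le> dist (fst x) a + dist (snd x) b"
      by (simp add: dist_add_right)
    then show "dist (fst x + snd x) (a + b) \<le> dist (dist (fst x) a + dist (snd x) b) 0"
      by (simp add: dist_real_def)
  next
    show "((\<lambda>x. dist (fst x) a + dist (snd x) b) \<longlongrightarrow> 0) (nhds a \<times>\<^sub>F nhds b)"
      by (intro tendsto_add_zero tendsto_dist_iff[THEN iffD1] filterlim_fst filterlim_snd)
  qed
next
  have dist_uminus: "dist (- x) (- y) = dist x y" for x y :: 'a
    using dist_add_right[of "-x" "x+y" "-y"] by (simp add: dist_commute)
  show "(uminus \<longlongrightarrow> - a) (nhds a)" for a :: 'a
    by (subst tendsto_dist_iff) (simp add: dist_uminus tendsto_dist_iff[THEN iffD1] tendsto_ident_at filterlim_ident)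
qed

lemma vabs_diff_eq_dist: "vabs (x - y) = dist x y"
  using dist_add_right[of "x - y" y 0] by (simp add: vabs_def)

lemma vabs_nonneg [simp]: "0 \<le> vabs x"
  by (simp add: vabs_def)

lemma vabs_eq_0_iff [simp]: "vabs x = 0 \<longleftrightarrow> x = 0"
  by (simp add: vabs_def)

lemma vabs_pos_iff [simp]: "0 < vabs x \<longleftrightarrow> x \<noteq> 0"
  by (simp add: vabs_def)

lemma vabs_0 [simp]: "vabs 0 = 0"
  by simp

lemma vabs_mult: "vabs (x * y) = vabs x * vabs y"
  by (simp add: vabs_def dist_mult_zero)

lemma vabs_1 [simp]: "vabs (1 :: 'a::complete_valued_field) = 1"
  using vabs_mult[of 1 "1::'a"] by simp

lemma vabs_minus [simp]: "vabs (- x) = vabs x"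
  using vabs_diff_eq_dist[of 0 x] by (simp add: vabs_def dist_commute)

lemma vabs_minus_commute: "vabs (x - y) = vabs (y - x)"
  by (simp add: vabs_diff_eq_dist dist_commute)

lemma vabs_divide: "vabs (x / y) = vabs x / vabs y"
  by (cases "y = 0") (use vabs_mult[of "x / y" y] in \<open>auto simp: field_simps\<close>)

lemma vabs_power: "vabs (x ^ n) = vabs x ^ n"
  by (induction n) (auto simp: vabs_mult)

lemma vabs_add: "vabs (x + y) \<le> max (vabs x) (vabs y)"
  using dist_ultrametric[of x "- y" 0] unfolding vabs_diff_eq_dist[symmetric] by simp

lemma vabs_add_le: "vabs x \<le> M \<Longrightarrow> vabs y \<le> M \<Longrightarrow> vabs (x + y) \<le> M"
  using vabs_add[of x y] by linarith

lemma vabs_diff_le: "vabs x \<le> M \<Longrightarrow> vabs y \<le> M \<Longrightarrow> vabs (x - y) \<le> M"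
  using vabs_add_le[of x M "- y"] by simp

lemma vabs_sum_le:
  assumes "\<And>i. i \<in> A \<Longrightarrow> vabs (f i) \<le> M" "0 \<le> M"
  shows "vabs (sum f A) \<le> M"
  using assms by (induction A rule: infinite_finite_induct) (auto intro: vabs_add_le)

lemma vabs_of_nat_le_1: "vabs (of_nat n :: 'a::complete_valued_field) \<le> 1"
  by (induction n) (auto intro: vabs_add_le)

lemma tendsto_0_iff_vabs: "(f \<longlongrightarrow> 0) F \<longleftrightarrow> ((\<lambda>x. vabs (f x)) \<longlongrightarrow> 0) F"
  unfolding vabs_def by (rule tendsto_dist_iff)

lemma tendsto_iff_vabs: "(f \<longlongrightarrow> a) F \<longleftrightarrow> ((\<lambda>x. vabs (f x - a)) \<longlongrightarrow> 0) F"
  unfolding vabs_diff_eq_dist by (rule tendsto_dist_iff)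

lemma tendsto_vabs: "(f \<longlongrightarrow> a) F \<Longrightarrow> ((\<lambda>x. vabs (f x)) \<longlongrightarrow> vabs a) F"
  unfolding vabs_def by (intro tendsto_dist tendsto_const)

lemma vabs_limit_le:
  assumes "X \<longlonglongrightarrow> x" "\<And>n. vabs (X n) \<le> M"
  shows "vabs x \<le> M"
  by (rule LIMSEQ_le_const2[OF tendsto_vabs[OF assms(1)]]) (use assms(2) in auto)

lemma tendsto_vmult_left:
  fixes c :: "'a::complete_valued_field"
  assumes "(f \<longlongrightarrow> a) F"
  shows "((\<lambda>x. c * f x) \<longlongrightarrow> c * a) F"
proof -
  have "((\<lambda>x. vabs c * vabs (f x - a)) \<longlongrightarrow> vabs c * 0) F"
    using assms by (intro tendsto_mult tendsto_const) (simp add: tendsto_iff_vabs)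
  then show ?thesis
    by (subst tendsto_iff_vabs) (simp flip: vabs_mult add: algebra_simps)
qed

lemma sums_vmult_left:
  fixes c :: "'a::complete_valued_field"
  assumes "f sums s"
  shows "(\<lambda>n. c * f n) sums (c * s)"
  using assms unfolding sums_def by (simp flip: sum_distrib_left add: tendsto_vmult_left)

lemma LIMSEQ_0_vabsI:
  assumes "\<And>e. e > 0 \<Longrightarrow> \<exists>n. \<forall>i\<ge>n. vabs (f i) < e"
  shows "f \<longlonglongrightarrow> 0"
  using assms unfolding tendsto_0_iff_vabs LIMSEQ_iff by simp

lemma LIMSEQ_0_vabsD:
  assumes "f \<longlonglongrightarrow> 0" "e > 0"
  obtains n where "\<And>i. i \<ge> n \<Longrightarrow> vabs (f i) < e"
proof -
  have "\<exists>n. \<forall>i\<ge>n. vabs (f i) < e"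
    using LIMSEQ_D[OF assms(1)[unfolded tendsto_0_iff_vabs] assms(2)] by simp
  then show thesis using that by blast
qed

text \<open>A block of consecutive terms is no larger than its largest term, so terms tending to 0
  already make the partial sums Cauchy.\<close>

lemma vabs_summable:
  fixes f :: "nat \<Rightarrow> 'a::complete_valued_field"
  assumes "f \<longlonglongrightarrow> 0"
  shows "summable f"
proof -
  have "Cauchy (\<lambda>n. \<Sum>i<n. f i)"
    unfolding Cauchy_altdef2
  proof (intro allI impI)
    fix e :: real assume "e > 0"
    then obtain N where N: "\<And>i. i \<ge> N \<Longrightarrow> vabs (f i) < e / 2"
      using LIMSEQ_0_vabsD[OF assms half_gt_zero] by metis
    have "dist (\<Sum>i<n. f i) (\<Sum>i<N. f i) < e" if "n \<ge> N" for n
    proof -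
      have "(\<Sum>i<n. f i) - (\<Sum>i<N. f i) = (\<Sum>i=N..<n. f i)"
        using sum_diff_nat_ivl[of 0 N n f] that by (simp add: atLeast0LessThan)
      moreover have "vabs (\<Sum>i=N..<n. f i) \<le> e / 2"
        using N \<open>e > 0\<close> by (intro vabs_sum_le) (auto intro: less_imp_le)
      ultimately show ?thesis
        using \<open>e > 0\<close> by (simp flip: vabs_diff_eq_dist)
    qed
    then show "\<exists>N. \<forall>n\<ge>N. dist (\<Sum>i<n. f i) (\<Sum>i<N. f i) < e"
      by blast
  qed
  then show ?thesis
    by (simp add: summable_iff_convergent Cauchy_convergent)
qed

lemma summable_imp_vabs_LIMSEQ_0:
  fixes f :: "nat \<Rightarrow> 'a::complete_valued_field"
  assumes "summable f"
  shows "f \<longlonglongrightarrow> 0"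
proof -
  obtain s where s: "(\<lambda>n. \<Sum>i<n. f i) \<longlonglongrightarrow> s"
    using assms by (auto simp: summable_def sums_def)
  from tendsto_diff[OF LIMSEQ_Suc[OF s] s] show ?thesis
    by simp
qed

lemma vabs_sums_le:
  assumes "f sums s" "\<And>n. vabs (f n) \<le> M" 
  shows "vabs s \<le> M"
  using assms(1) unfolding sums_def
  by (rule vabs_limit_le) (use assms(2) order_trans[OF vabs_nonneg assms(2)] in \<open>auto intro: vabs_sum_le\<close>)

lemma vabs_suminf_le:
  "summable f \<Longrightarrow> (\<And>n. vabs (f n) \<le> M) \<Longrightarrow> vabs (suminf f) \<le> M"
  by (rule vabs_sums_le[OF summable_sums])

lemma LIMSEQ_0_vabs_le:
  assumes "g \<longlonglongrightarrow> 0" "\<And>n. vabs (f n) \<le> g n"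
  shows "f \<longlonglongrightarrow> 0"
  unfolding tendsto_0_iff_vabs
  by (rule tendsto_sandwich[OF _ _ tendsto_const assms(1)]) (use assms(2) in auto)

lemma vsums_shift_iff:
  fixes f :: "nat \<Rightarrow> 'a::complete_valued_field"
  shows "(\<lambda>i. f (i + n)) sums (s - (\<Sum>i<n. f i)) \<longleftrightarrow> f sums s"
proof -
  have split: "(\<Sum>i<m + n. f i) = (\<Sum>i<m. f (i + n)) + (\<Sum>i<n. f i)" for m
    by (induction m) (auto simp: add_ac)
  show ?thesis
  proof
    assume "(\<lambda>i. f (i + n)) sums (s - (\<Sum>i<n. f i))"
    then have "(\<lambda>m. (\<Sum>i<m. f (i + n)) + (\<Sum>i<n. f i)) \<longlonglongrightarrow> s - (\<Sum>i<n. f i) + (\<Sum>i<n. f i)"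
      unfolding sums_def by (intro tendsto_add tendsto_const)
    then show "f sums s"
      unfolding sums_def split[symmetric] by (simp add: LIMSEQ_offset)
  next
    assume "f sums s"
    then have "(\<lambda>m. (\<Sum>i<m + n. f i) - (\<Sum>i<n. f i)) \<longlonglongrightarrow> s - (\<Sum>i<n. f i)"
      unfolding sums_def by (intro tendsto_diff tendsto_const LIMSEQ_ignore_initial_segment)
    then show "(\<lambda>i. f (i + n)) sums (s - (\<Sum>i<n. f i))"
      unfolding sums_def split by simp
  qed
qed

lemma LIMSEQ_0_vmult_bounded:
  assumes "c \<longlonglongrightarrow> 0" "\<And>k. vabs (z k) \<le> M"
  shows "(\<lambda>k. c k * z k) \<longlonglongrightarrow> 0"
proof (rule LIMSEQ_0_vabs_le)
  show "(\<lambda>k. vabs (c k) * M) \<longlonglongrightarrow> 0"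
    using assms(1) by (intro tendsto_mult_left_zero) (simp add: tendsto_0_iff_vabs)
qed (auto simp: vabs_mult intro!: mult_left_mono assms(2))

lemma LIMSEQ_0_vabs_bounded:
  assumes "f \<longlonglongrightarrow> 0"
  obtains B where "\<And>n. vabs (f n) \<le> B"
proof -
  have "Bseq (\<lambda>n. vabs (f n))"
    using assms by (intro convergent_imp_Bseq convergentI) (simp add: tendsto_0_iff_vabs)
  then show thesis
    using that by (auto simp: Bseq_def)
qed

lemma vabs_suminf_diff_le:
  assumes "summable f" "0 \<le> e" "\<And>i. i \<ge> n \<Longrightarrow> vabs (f i) \<le> e"
  shows "vabs (suminf f - (\<Sum>i<n. f i)) \<le> e"
proof -
  have "(\<lambda>i. f (i + n)) sums (suminf f - (\<Sum>i<n. f i))"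
    by (simp add: vsums_shift_iff summable_sums[OF assms(1)])
  then show ?thesis
    by (rule vabs_sums_le) (use assms in auto)
qed

text \<open>The ultrametric substitute for absolute summability of a double series: outside a finite
  square all entries are small. The condition is symmetric in the two indices.\<close>

definition null_family :: "(nat \<Rightarrow> nat \<Rightarrow> 'a::complete_valued_field) \<Rightarrow> bool" where
  "null_family f \<longleftrightarrow> (\<forall>e>0. \<exists>n. \<forall>i j. n \<le> i \<or> n \<le> j \<longrightarrow> vabs (f i j) < e)"

lemma null_family_flip: "null_family f \<Longrightarrow> null_family (\<lambda>i j. f j i)"
  unfolding null_family_def by blast

lemma null_family_row:
  assumes "null_family f"
  shows "summable (f i)"
  using assms unfolding null_family_def by (intro vabs_summable LIMSEQ_0_vabsI) blast

lemma null_family_summable: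
  assumes "null_family f"
  shows "summable (\<lambda>i. suminf (f i))"
proof -
  show "summable (\<lambda>i. suminf (f i))"
  proof (intro vabs_summable LIMSEQ_0_vabsI)
    fix d :: real assume "d > 0"
    then obtain m where m: "\<And>i j. m \<le> i \<or> m \<le> j \<Longrightarrow> vabs (f i j) < d / 2"
      using assms unfolding null_family_def by (meson half_gt_zero)
    have "vabs (suminf (f i)) \<le> d / 2" if "i \<ge> m" for i
      using m that by (intro vabs_suminf_le null_family_row[OF assms]) (auto intro: less_imp_le)
    then have "vabs (suminf (f i)) < d" if "i \<ge> m" for i
      using that \<open>d > 0\<close> by fastforce
    then show "\<exists>n. \<forall>i\<ge>n. vabs (suminf (f i)) < d"
      by blast
  qed
qed

lemma null_family_box:
  assumes "null_family f" "0 \<le> e" "\<And>i j. n \<le> i \<or> n \<le> j \<Longrightarrow> vabs (f i j) \<le> e"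
  shows "vabs (suminf (\<lambda>i. suminf (f i)) - (\<Sum>i<n. \<Sum>j<n. f i j)) \<le> e"
proof -
  have row: "summable (f i)" for i
    using assms(1) by (rule null_family_row)
  note sm = null_family_summable[OF assms(1)]
  have *: "suminf (\<lambda>i. suminf (f i)) - (\<Sum>i<n. \<Sum>j<n. f i j) =
        (suminf (\<lambda>i. suminf (f i)) - (\<Sum>i<n. suminf (f i))) + (\<Sum>i<n. suminf (f i) - (\<Sum>j<n. f i j))"
    by (simp add: sum_subtractf)
  show "vabs (suminf (\<lambda>i. suminf (f i)) - (\<Sum>i<n. \<Sum>j<n. f i j)) \<le> e"
    unfolding * using assms row sm
    by (intro vabs_add_le vabs_sum_le vabs_suminf_diff_le vabs_suminf_le) auto
qed

text \<open>By \<open>null_family_box\<close> both iterated sums are within e of the same finite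
  square sum, hence within e of each other; taking e as half their supposed distance gives the
  contradiction.\<close>

lemma null_family_swap:
  assumes "null_family f"
  shows "(\<Sum>i. \<Sum>j. f i j) = (\<Sum>j. \<Sum>i. f i j)" (is "?S = ?T")
proof (rule ccontr)
  assume "?S \<noteq> ?T"
  define e where "e = vabs (?S - ?T) / 2"
  have "e > 0" using \<open>?S \<noteq> ?T\<close> by (simp add: e_def)
  then obtain n where n: "\<And>i j. n \<le> i \<or> n \<le> j \<Longrightarrow> vabs (f i j) < e"
    using assms unfolding null_family_def by blast
  have "vabs (?S - (\<Sum>i<n. \<Sum>j<n. f i j)) \<le> e"
    using n \<open>e > 0\<close> by (intro null_family_box[OF assms]) (auto intro: less_imp_le)
  moreover have "vabs (?T - (\<Sum>i<n. \<Sum>j<n. f j i)) \<le> e"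
    using n \<open>e > 0\<close> by (intro null_family_box[OF null_family_flip[OF assms]]) (auto intro: less_imp_le)
  ultimately have "vabs ((?S - (\<Sum>i<n. \<Sum>j<n. f i j)) - (?T - (\<Sum>i<n. \<Sum>j<n. f j i))) \<le> e"
    by (rule vabs_diff_le)
  also have "(\<Sum>i<n. \<Sum>j<n. f j i) = (\<Sum>i<n. \<Sum>j<n. f i j)"
    by (rule sum.swap)
  finally show False
    using \<open>e > 0\<close> by (simp add: e_def not_less[symmetric])
qed

lemma null_family_sums_cols:
  assumes "null_family f" "\<And>i. f i sums r i" "\<And>j. (\<lambda>i. f i j) sums c j"
  shows "c sums suminf r"
proof -
  have r: "r = (\<lambda>i. suminf (f i))" and c: "c = (\<lambda>j. suminf (\<lambda>i. f i j))"
    using assms by (auto simp: sums_iff)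
  have "summable c"
    unfolding c using null_family_summable[OF null_family_flip[OF assms(1)]] .
  moreover have "suminf r = suminf c"
    unfolding r c by (rule null_family_swap[OF assms(1)])
  ultimately show ?thesis
    using summable_sums[of c] by simp
qed

text \<open>Row i of the double family is y shifted by i and scaled by x_i, so it sums to x_i b;
  column n is the finite n-th coefficient of the product.\<close>

lemma Cauchy_product_vsums:
  fixes x y :: "nat \<Rightarrow> 'a::complete_valued_field"
  assumes "x sums a" "y sums b"
  shows "(\<lambda>n. \<Sum>i\<le>n. x i * y (n - i)) sums (a * b)"
proof -
  define f where "f = (\<lambda>i n. if i \<le> n then x i * y (n - i) else 0)"
  have x0: "x \<longlonglongrightarrow> 0" and y0: "y \<longlonglongrightarrow> 0"
    using assms by (auto intro: summable_imp_vabs_LIMSEQ_0 sums_summable)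
  obtain Bx By where "\<And>n. vabs (x n) \<le> Bx" "\<And>n. vabs (y n) \<le> By"
    using LIMSEQ_0_vabs_bounded[OF x0] LIMSEQ_0_vabs_bounded[OF y0] by metis
  then obtain B where B: "B > 0" "\<And>n. vabs (x n) \<le> B" "\<And>n. vabs (y n) \<le> B"
    by (intro that[of "max 1 (max Bx By)"]) (auto simp: le_max_iff_disj)
  have "null_family f"
    unfolding null_family_def
  proof (intro allI impI)
    fix e :: real assume "e > 0"
    then have "e / B > 0" using B by simp
    then obtain n1 n2 where n: "\<And>i. i \<ge> n1 \<Longrightarrow> vabs (x i) < e / B" "\<And>i. i \<ge> n2 \<Longrightarrow> vabs (y i) < e / B"
      using LIMSEQ_0_vabsD[OF x0] LIMSEQ_0_vabsD[OF y0] by metis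
    have "vabs (f i j) < e" if "n1 + n2 \<le> i \<or> n1 + n2 \<le> j" for i j
    proof (cases "i \<le> j")
      case True
      \<comment> \<open>Since i + (j - i) = j >= n1 + n2, one of the two factors has a large index;
        the other is bounded by B.\<close>
      then have "n1 \<le> i \<or> n2 \<le> j - i"
        using that by auto
      then have "vabs (x i) * vabs (y (j - i)) < e"
      proof
        assume "n1 \<le> i"
        then have "vabs (x i) * vabs (y (j - i)) \<le> vabs (x i) * B" "vabs (x i) * B < e"
          using n(1) B by (auto intro!: mult_left_mono simp flip: pos_less_divide_eq)
        then show ?thesis by simp
      next
        assume "n2 \<le> j - i"
        then have "vabs (x i) * vabs (y (j - i)) \<le> B * vabs (y (j - i))" "vabs (y (j - i)) * B < e"
          using n(2) B by (auto intro!: mult_right_mono simp flip: pos_less_divide_eq)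
        then show ?thesis by (simp add: mult.commute)
      qed
      then show ?thesis
        using True by (simp add: f_def vabs_mult)
    qed (use \<open>e > 0\<close> in \<open>simp add: f_def\<close>)
    then show "\<exists>n. \<forall>i j. n \<le> i \<or> n \<le> j \<longrightarrow> vabs (f i j) < e"
      by blast
  qed
  moreover have row: "f i sums (x i * b)" for i
  proof -
    have "(\<lambda>n. f i (n + i)) sums (x i * b)"
      using assms(2) by (simp add: f_def sums_vmult_left)
    then show ?thesis
      using vsums_shift_iff[of "f i" i "x i * b"] by (simp add: f_def)
  qed
  moreover have "(\<lambda>i. f i n) sums (\<Sum>i\<le>n. x i * y (n - i))" for n
    using sums_finite[of "{..n}" "\<lambda>i. f i n"] by (simp add: f_def)
  moreover have "(\<lambda>i. x i * b) sums (a * b)"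
    using sums_vmult_left[OF assms(1), of b] by (simp add: mult.commute)
  ultimately show ?thesis
    using null_family_sums_cols[of f "\<lambda>i. x i * b" "\<lambda>n. \<Sum>i\<le>n. x i * y (n - i)"]
    by (simp add: sums_iff)
qed

text \<open>Ultrametric dominated convergence: the common bound M makes the tails small uniformly in
  N, and the finite head converges termwise.\<close>

lemma vsums_dominated_LIMSEQ:
  fixes c :: "nat \<Rightarrow> 'a::complete_valued_field"
  assumes "c \<longlonglongrightarrow> 0" "\<And>k. (\<lambda>N. g N k) \<longlonglongrightarrow> h k" "\<And>N k. vabs (g N k) \<le> M"
  shows "(\<lambda>N. \<Sum>k. c k * g N k) \<longlonglongrightarrow> (\<Sum>k. c k * h k)"
proof -
  have M: "M \<ge> 0"
    using order_trans[OF vabs_nonneg assms(3)] .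
  have h: "vabs (h k) \<le> M" for k
    using assms(2,3) by (rule vabs_limit_le)
  have sg: "summable (\<lambda>k. c k * g N k)" and sh: "summable (\<lambda>k. c k * h k)" for N
    using assms(3) h by (blast intro: vabs_summable LIMSEQ_0_vmult_bounded[OF assms(1)])+
  have "(\<lambda>N. (\<Sum>k. c k * g N k) - (\<Sum>k. c k * h k)) \<longlonglongrightarrow> 0"
  proof (rule LIMSEQ_0_vabsI)
    fix e :: real assume e: "e > 0"
    \<comment> \<open>Using M + 1 keeps the quotient meaningful when M = 0.\<close>
    then have "e / (2 * (M + 1)) > 0" using M by simp
    from LIMSEQ_0_vabsD[OF assms(1) this]
    obtain n where n: "\<And>k. k \<ge> n \<Longrightarrow> vabs (c k) < e / (2 * (M + 1))" by metis
    have small: "vabs (c k * z) \<le> e / 2" if "k \<ge> n" "vabs z \<le> M" for k z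
    proof -
      have "vabs (c k * z) \<le> e / (2 * (M + 1)) * (M + 1)"
        unfolding vabs_mult using n[OF that(1)] that M e by (intro mult_mono) auto
      also have "\<dots> = e / 2" using M by (simp add: divide_simps)
      finally show ?thesis .
    qed
    have "(\<lambda>N. (\<Sum>k<n. c k * g N k) - (\<Sum>k<n. c k * h k)) \<longlonglongrightarrow> 0"
      using tendsto_diff[OF tendsto_sum[of "{..<n}" "\<lambda>k N. c k * g N k", OF tendsto_vmult_left[OF assms(2)]]
          tendsto_const[of "\<Sum>k<n. c k * h k"]] by simp
    from LIMSEQ_0_vabsD[OF this half_gt_zero[OF e]]
    obtain N0 where N0: "\<And>N. N \<ge> N0 \<Longrightarrow> vabs ((\<Sum>k<n. c k * g N k) - (\<Sum>k<n. c k * h k)) < e / 2" by metis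
    have "vabs ((\<Sum>k. c k * g N k) - (\<Sum>k. c k * h k)) < e" if "N \<ge> N0" for N
    proof -
      have "(\<Sum>k. c k * g N k) - (\<Sum>k. c k * h k) =
          ((\<Sum>k. c k * g N k) - (\<Sum>k<n. c k * g N k)) + 
          (((\<Sum>k<n. c k * g N k) - (\<Sum>k<n. c k * h k)) - ((\<Sum>k. c k * h k) - (\<Sum>k<n. c k * h k)))"
        by simp
      also have "vabs \<dots> \<le> e / 2"
      proof (intro vabs_add_le[OF _ vabs_diff_le] vabs_suminf_diff_le sg sh)
        show "vabs ((\<Sum>k<n. c k * g N k) - (\<Sum>k<n. c k * h k)) \<le> e / 2"
          using N0[OF that] by simp
      qed (use e small assms(3) h in auto)
      finally show ?thesis using e by simp
    qed
    then show "\<exists>n. \<forall>N\<ge>n. vabs ((\<Sum>k. c k * g N k) - (\<Sum>k. c k * h k)) < e"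
      by blast
  qed
  then show ?thesis
    by (simp add: tendsto_iff_vabs[of _ "suminf _"] tendsto_0_iff_vabs)
qed

section \<open>$p$-adic estimates, exponential and logarithm\<close>

text \<open>The strictly larger summand determines the size. This yields exact absolute values of
  q-numbers, not only upper bounds.\<close>

lemma vabs_add_eq:
  assumes "vabs y < vabs x"
  shows "vabs (x + y) = vabs x"
proof (rule antisym)
  show "vabs (x + y) \<le> vabs x"
    using assms by (intro vabs_add_le) auto
  show "vabs x \<le> vabs (x + y)"
    using vabs_add[of "x + y" "- y"] assms by simp
qed

locale padic_valuation =
  fixes p :: nat and field_type :: "'a::complete_valued_field itself"
  assumes prime_p: "prime p"
    and vabs_of_int: "\<And>k. k \<noteq> 0 \<Longrightarrow> vabs (of_int k :: 'a) = (1 / real p) ^ multiplicity (int p) k"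
begin

abbreviation radius :: real where "radius \<equiv> conv_radius_exp p"

lemma p_gt_1: "1 < p"
  using prime_p by (rule prime_gt_1_nat)

lemma vabs_p: "vabs (of_nat p :: 'a) = 1 / real p"
  using vabs_of_int[of "int p"] prime_p p_gt_1 by simp

lemma vabs_of_nat_dvd:
  assumes "p dvd n"
  shows "vabs (of_nat n :: 'a) \<le> 1 / real p"
proof -
  obtain k where "n = p * k" using assms by blast
  then show ?thesis
    using vabs_of_nat_le_1[of k, where 'a='a] p_gt_1 by (simp add: vabs_mult vabs_p divide_simps)
qed

lemma vabs_of_nat_not_dvd:
  assumes "\<not> p dvd n"
  shows "vabs (of_nat n :: 'a) = 1"
proof -
  have "n \<noteq> 0" using assms by (auto intro: Nat.gr0I)
  moreover have "multiplicity (int p) (int n) = 0"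
    using assms by (intro not_dvd_imp_multiplicity_0) simp
  ultimately show ?thesis
    using vabs_of_int[of "int n"] by simp
qed

lemma radius_pos: "0 < radius"
  using p_gt_1 by (simp add: conv_radius_exp_def)

lemma radius_power: "radius ^ (p - 1) = 1 / real p"
proof -
  have "radius ^ (p - 1) = real p powr (- 1 / (real p - 1) * real (p - 1))"
    using p_gt_1 by (simp add: conv_radius_exp_def powr_powr flip: powr_realpow)
  also have "- 1 / (real p - 1) * real (p - 1) = -1"
    using p_gt_1 by (simp add: of_nat_diff)
  finally show ?thesis
    using p_gt_1 by (simp add: powr_minus field_simps)
qed

lemma radius_less_1: "radius < 1"
proof (rule ccontr)
  assume "\<not> radius < 1"
  then have "1 \<le> radius ^ (p - 1)"
    by (intro one_le_power) simp
  then show False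
    using p_gt_1 unfolding radius_power by simp
qed

section \<open>The p-adic size of factorials\<close>

lemma vabs_fact_le_1: "vabs (fact n :: 'a) \<le> 1"
  using vabs_of_nat_le_1[of "fact n"] by simp

lemma vabs_fact_add:
  "r < p \<Longrightarrow> vabs (fact (p * k + r) :: 'a) = vabs (fact (p * k) :: 'a)"
proof (induction r)
  case (Suc r)
  have "\<not> p dvd Suc (p * k + r)"
    using Suc.prems by (metis add_Suc_right dvd_add_right_iff dvd_triv_left nat_dvd_not_less zero_less_Suc)
  then show ?case
    using Suc by (simp add: vabs_mult vabs_of_nat_not_dvd flip: of_nat_Suc del: of_nat_Suc)
qed simp

text \<open>Among the factors of (pk)! only p, 2p, ..., kp are divisible by p, and their product is
  p^k k!.\<close>

lemma vabs_fact_mult: "vabs (fact (p * k) :: 'a) = (1 / real p) ^ k * vabs (fact k :: 'a)"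
proof (induction k)
  case (Suc k)
  have "p * Suc k = Suc (p * k + (p - 1))"
    using p_gt_1 by simp
  then have "(fact (p * Suc k) :: 'a) = of_nat (p * Suc k) * fact (p * k + (p - 1))"
    by (metis fact_Suc)
  then have "vabs (fact (p * Suc k) :: 'a) = vabs (of_nat p :: 'a) * vabs (of_nat (Suc k) :: 'a) * vabs (fact (p * k) :: 'a)"
    using p_gt_1 vabs_fact_add[of "p - 1" k] by (simp add: vabs_mult del: of_nat_Suc mult_Suc_right)
  then show ?case
    by (simp add: vabs_mult vabs_p Suc.IH)
qed simp

text \<open>Legendre's estimate $v_p(m!) \<le> (m - 1)/(p - 1)$.\<close>

lemma radius_power_le_vabs_fact: "radius ^ (m - 1) \<le> vabs (fact m :: 'a)"
proof (induction m rule: less_induct)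
  case (less m)
  define k r where "k = m div p" and "r = m mod p"
  have m: "m = p * k + r" and "r < p"
    using p_gt_1 by (auto simp: k_def r_def)
  then have eq: "vabs (fact m :: 'a) = (1 / real p) ^ k * vabs (fact k :: 'a)"
    by (simp add: vabs_fact_add vabs_fact_mult)
  show ?case
  proof (cases "k = 0")
    case True
    then show ?thesis
      using radius_pos radius_less_1 by (simp add: eq power_le_one)
  next
    case False
    have "k < m" using False m p_gt_1
      by (metis add_lessD1 div_less_dividend k_def div_0 gr0I)
    \<comment> \<open>The factor p^(-k) is radius^((p-1)k), and the induction hypothesis contributes
      k - 1; as k > 0, the total is pk - 1.\<close>
    have exp: "(p - 1) * k + (k - 1) \<le> m - 1"
    proof -
      have "(p - 1) * k + k = p * k"
        using p_gt_1 by (simp add: algebra_simps)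
      then show ?thesis using m False by linarith
    qed
    have "radius ^ (m - 1) \<le> radius ^ ((p - 1) * k + (k - 1))"
      using radius_pos radius_less_1 exp by (intro power_decreasing) auto
    also have "\<dots> = (1 / real p) ^ k * radius ^ (k - 1)"
      by (simp only: power_add power_mult radius_power)
    also have "\<dots> \<le> (1 / real p) ^ k * vabs (fact k :: 'a)"
      using less.IH[OF \<open>k < m\<close>] by (intro mult_left_mono) auto
    finally show ?thesis by (simp add: eq)
  qed
qed

lemma power_div_vabs_fact_le:
  assumes "0 \<le> \<rho>"
  shows "\<rho> ^ m / vabs (fact m :: 'a) \<le> (\<rho> / radius) ^ m"
proof -
  have "radius ^ m \<le> radius ^ (m - 1)"
    using radius_pos radius_less_1 by (intro power_decreasing) auto
  then have "radius ^ m \<le> vabs (fact m :: 'a)"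
    using radius_power_le_vabs_fact[of m] by linarith
  then show ?thesis
    using radius_pos assms by (simp add: power_divide frac_le)
qed

text \<open>Legendre's exponent m - 1 instead of m leaves one factor \<rho> over. Hence the
  nonconstant terms of exp and log at z are at most |z|.\<close>

lemma power_Suc_div_vabs_fact_le:
  assumes "0 \<le> \<rho>" "\<rho> \<le> radius"
  shows "\<rho> ^ Suc m / vabs (fact (Suc m) :: 'a) \<le> \<rho>"
proof -
  have "\<rho> ^ Suc m \<le> \<rho> * radius ^ m"
    using assms by (auto intro!: mult_left_mono power_mono)
  also have "\<dots> \<le> \<rho> * vabs (fact (Suc m) :: 'a)"
    using assms radius_power_le_vabs_fact[of "Suc m"] by (intro mult_left_mono) auto
  finally show ?thesis
    by (simp add: divide_simps del: fact_Suc)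
qed

lemma power_div_vabs_fact_LIMSEQ:
  assumes "0 \<le> \<rho>" "\<rho> < radius"
  shows "(\<lambda>m. \<rho> ^ m / vabs (fact m :: 'a)) \<longlonglongrightarrow> 0"
proof (rule tendsto_sandwich[OF _ _ tendsto_const])
  show "(\<lambda>m. (\<rho> / radius) ^ m) \<longlonglongrightarrow> 0"
    using assms radius_pos by (intro LIMSEQ_power_zero) auto
qed (use assms power_div_vabs_fact_le in auto)

text \<open>As n + 1 divides (n + 1)!, the estimates for the exponential series also control the
  logarithm.\<close>

lemma vabs_inverse_Suc_le: "1 / vabs (of_nat (Suc n) :: 'a) \<le> 1 / vabs (fact (Suc n) :: 'a)"
proof (rule divide_left_mono)
  show "vabs (fact (Suc n) :: 'a) \<le> vabs (of_nat (Suc n) :: 'a)"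
    using vabs_fact_le_1[of n] by (simp add: vabs_mult mult_left_le del: of_nat_Suc)
qed (auto simp del: of_nat_Suc fact_Suc)

section \<open>Exponential and logarithm on their common disc\<close>

lemma exp_terms_LIMSEQ:
  fixes z :: 'a
  assumes "vabs z < radius"
  shows "(\<lambda>n. z ^ n / fact n) \<longlonglongrightarrow> 0"
  using power_div_vabs_fact_LIMSEQ[OF vabs_nonneg assms]
  by (subst tendsto_0_iff_vabs) (simp add: vabs_divide vabs_power)

lemma vexp_sums:
  fixes z :: 'a
  assumes "vabs z < radius"
  shows "(\<lambda>n. z ^ n / fact n) sums vexp z"
  unfolding vexp_def using exp_terms_LIMSEQ[OF assms] by (intro summable_sums vabs_summable)

lemma vexp_0 [simp]: "vexp (0 :: 'a) = 1"
proof -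
  have "(\<lambda>n. 0 ^ n / fact n :: 'a) sums (\<Sum>n\<in>{0}. 0 ^ n / fact n)"
    by (rule sums_finite) auto
  then show ?thesis
    unfolding vexp_def by (simp add: sums_iff)
qed

lemma vexp_add:
  fixes x y :: 'a
  assumes "vabs x < radius" "vabs y < radius"
  shows "vexp (x + y) = vexp x * vexp y"
proof -
  have "(\<lambda>n. \<Sum>i\<le>n. x ^ i / fact i * (y ^ (n - i) / fact (n - i))) sums (vexp x * vexp y)"
    using assms by (intro Cauchy_product_vsums vexp_sums)
  moreover have "(\<Sum>i\<le>n. x ^ i / fact i * (y ^ (n - i) / fact (n - i))) = (x + y) ^ n / fact n" for n
    by (simp add: binomial_ring sum_divide_distrib)
       (intro sum.cong refl, simp add: binomial_fact field_simps)
  ultimately show ?thesis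
    unfolding vexp_def by (simp add: sums_iff)
qed

lemma vabs_vexp_minus_1_le:
  fixes z :: 'a
  assumes "vabs z < radius"
  shows "vabs (vexp z - 1) \<le> vabs z"
proof -
  have "(\<lambda>n. z ^ Suc n / fact (Suc n)) sums (vexp z - 1)"
    using vexp_sums[OF assms] vsums_shift_iff[of "\<lambda>n. z ^ n / fact n" 1] by simp
  then show ?thesis
    by (rule vabs_sums_le)
       (use power_Suc_div_vabs_fact_le assms in \<open>simp add: vabs_divide vabs_power del: fact_Suc power_Suc\<close>)
qed

lemma vabs_log_term_le:
  fixes z :: 'a
  shows "vabs ((-1) ^ n * z ^ Suc n / of_nat (Suc n)) \<le> vabs z ^ Suc n / vabs (fact (Suc n) :: 'a)"
proof -
  have "vabs ((-1) ^ n * z ^ Suc n / of_nat (Suc n)) = vabs z ^ Suc n * (1 / vabs (of_nat (Suc n) :: 'a))"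
    by (simp add: vabs_mult vabs_divide vabs_power del: of_nat_Suc)
  also have "\<dots> \<le> vabs z ^ Suc n * (1 / vabs (fact (Suc n) :: 'a))"
    by (intro mult_left_mono vabs_inverse_Suc_le) simp
  finally show ?thesis by simp
qed

lemma vlog_sums:
  fixes z :: 'a
  assumes "vabs z < radius"
  shows "(\<lambda>n. (-1) ^ n * z ^ Suc n / of_nat (Suc n)) sums vlog (1 + z)"
proof -
  have "(\<lambda>n. (-1) ^ n * z ^ Suc n / of_nat (Suc n)) \<longlonglongrightarrow> 0"
    by (rule LIMSEQ_0_vabs_le[OF LIMSEQ_Suc[OF power_div_vabs_fact_LIMSEQ[OF vabs_nonneg assms]]])
       (rule vabs_log_term_le)
  then show ?thesis
    unfolding vlog_def by (simp add: vabs_summable summable_sums del: power_Suc of_nat_Suc)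
qed

lemma vabs_vlog_le:
  fixes z :: 'a
  assumes "vabs z < radius"
  shows "vabs (vlog (1 + z)) \<le> vabs z"
  using assms
  by (intro vabs_sums_le[OF vlog_sums[OF assms]] order_trans[OF vabs_log_term_le] power_Suc_div_vabs_fact_le) auto

end

subsection \<open>Degenerate falling factorials\<close>

text \<open>Kept as a polynomial in a, because a linear functional a^k |-> \<gamma>_k is later
  applied to its coefficients.\<close>

definition degen_ffact :: "'a::comm_ring_1 \<Rightarrow> nat \<Rightarrow> 'a poly" where
  "degen_ffact lam m = (\<Prod>i<m. [:- (of_nat i * lam), 1:])"

lemma degen_ffact_0 [simp]: "degen_ffact lam 0 = 1"
  by (simp add: degen_ffact_def)

lemma degen_ffact_Suc: "degen_ffact lam (Suc m) = degen_ffact lam m * [:- (of_nat m * lam), 1:]"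
  by (simp add: degen_ffact_def)

lemma coeff_mult_linear:
  fixes P :: "'a::comm_ring_1 poly"
  shows "coeff (P * [:- c, 1:]) (Suc k) = coeff P k - c * coeff P (Suc k)"
    and "coeff (P * [:- c, 1:]) 0 = - c * coeff P 0"
  by simp_all

lemma coeff_degen_ffact_Suc:
  "coeff (degen_ffact lam (Suc m)) (Suc k) =
     coeff (degen_ffact lam m) k - of_nat m * lam * coeff (degen_ffact lam m) (Suc k)"
  by (simp only: degen_ffact_Suc coeff_mult_linear)

lemma coeff_degen_ffact_0: "coeff (degen_ffact lam m) 0 = (if m = 0 then 1 else 0)"
  by (induction m) (simp_all only: degen_ffact_Suc coeff_mult_linear degen_ffact_0, auto)

lemma degree_degen_ffact_le: "degree (degen_ffact (lam :: 'a::{comm_ring_1,ring_no_zero_divisors}) m) \<le> m"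
proof (induction m)
  case (Suc m)
  have "degree (degen_ffact lam (Suc m)) \<le> degree (degen_ffact lam m) + degree [:- (of_nat m * lam), 1:]"
    unfolding degen_ffact_Suc by (rule degree_mult_le)
  then show ?case using Suc by simp
qed simp

lemma coeff_degen_ffact_eq_0:
  "m < k \<Longrightarrow> coeff (degen_ffact (lam :: 'a::{comm_ring_1,ring_no_zero_divisors}) m) k = 0"
  using degree_degen_ffact_le[of lam m] by (intro coeff_eq_0) linarith

text \<open>Multiplication by a sends the m-th falling factorial to the (m+1)-st plus m
  \<open>lam\<close> times the m-th, which mirrors the recurrence of the Stirling numbers.\<close>

lemma monom_eq_sum_degen_ffact:
  "monom 1 n = (\<Sum>m\<le>n. smult (lam ^ (n - m) * of_nat (Stirling n m)) (degen_ffact lam m))"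
proof (induction n)
  case (Suc n)
  let ?c = "\<lambda>n m. lam ^ (n - m) * of_nat (Stirling n m)"
  have X: "monom 1 1 * degen_ffact lam m = degen_ffact lam (Suc m) + smult (of_nat m * lam) (degen_ffact lam m)" for m
    by (simp add: degen_ffact_Suc monom_altdef algebra_simps)
  have "monom 1 (Suc n) = monom 1 1 * (monom 1 n :: 'a poly)"
    by (simp add: mult_monom)
  also have "\<dots> = (\<Sum>m\<le>n. smult (?c n m) (monom 1 1 * degen_ffact lam m))"
    by (subst Suc) (simp add: sum_distrib_left)
  also have "\<dots> = (\<Sum>m\<le>n. smult (?c n m) (degen_ffact lam (Suc m))) +
      (\<Sum>m\<le>n. smult (of_nat m * lam * ?c n m) (degen_ffact lam m))"
    unfolding X by (simp add: smult_add_right sum.distrib mult_ac)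
  \<comment> \<open>The added term vanishes with \<open>Stirling n (Suc n)\<close> and the term at 0
    with its factor m, so the index shift below loses nothing.\<close>
  also have "(\<Sum>m\<le>n. smult (of_nat m * lam * ?c n m) (degen_ffact lam m)) =
      (\<Sum>m\<le>Suc n. smult (of_nat m * lam * ?c n m) (degen_ffact lam m))"
    by simp
  also have "\<dots> = (\<Sum>m\<le>n. smult (of_nat (Suc m) * lam * ?c n (Suc m)) (degen_ffact lam (Suc m)))"
    by (subst sum.atMost_Suc_shift) simp
  also have "(\<Sum>m\<le>n. smult (?c n m) (degen_ffact lam (Suc m))) + \<dots> =
      (\<Sum>m\<le>n. smult (?c (Suc n) (Suc m)) (degen_ffact lam (Suc m)))"
    unfolding sum.distrib[symmetric] smult_add_left[symmetric]
  proof (intro sum.cong refl arg_cong2[where f = smult])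
    fix m assume "m \<in> {..n}"
    \<comment> \<open>Truncated subtraction breaks n - m = Suc (n - Suc m) at m = n; there the
      second summand is 0 anyway.\<close>
    then consider "m = n" | "Suc m \<le> n" by fastforce
    then show "?c n m + of_nat (Suc m) * lam * ?c n (Suc m) = ?c (Suc n) (Suc m)"
    proof cases
      case 2
      then have "n - m = Suc (n - Suc m)" by simp
      then show ?thesis by (simp add: algebra_simps)
    qed simp
  qed
  also have "\<dots> = (\<Sum>m\<le>Suc n. smult (?c (Suc n) m) (degen_ffact lam m))"
    by (simp add: sum.atMost_Suc_shift del: sum.atMost_Suc)
  finally show ?case .
qed simp

text \<open>
  The sequence $s_m$ of coefficients of $a^k$ in $a (a - \lambda) \cdots (a - (m-1) \lambda)$ has the
  exponential generating function $(\log(1 + \lambda t)/\lambda)^k / k!$.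
\<close>

definition fps_degen_log :: "'a::field_char_0 \<Rightarrow> 'a fps" where
  "fps_degen_log lam = Abs_fps (\<lambda>n. if n = 0 then 0 else (- lam) ^ (n - 1) / of_nat n)"

definition fps_degen_ffact :: "'a::field_char_0 \<Rightarrow> nat \<Rightarrow> 'a fps" where
  "fps_degen_ffact lam k = Abs_fps (\<lambda>m. coeff (degen_ffact lam m) k / fact m)"

lemma fps_deriv_degen_log:
  "(1 + fps_const lam * fps_X) * fps_deriv (fps_degen_log lam) = 1"
proof (rule fps_ext)
  fix n show "((1 + fps_const lam * fps_X) * fps_deriv (fps_degen_log lam)) $ n = 1 $ n"
    by (cases n) (simp_all add: fps_degen_log_def distrib_right mult.assoc del: of_nat_Suc)
qed

text \<open>The recurrence \<open>coeff_degen_ffact_Suc\<close>, rewritten as a differential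
  equation for the generating series.\<close>

lemma fps_deriv_degen_ffact:
  "(1 + fps_const lam * fps_X) * fps_deriv (fps_degen_ffact lam (Suc k)) = fps_degen_ffact lam k"
proof (rule fps_ext)
  fix n
  have nth: "fps_deriv (fps_degen_ffact lam (Suc k)) $ m = coeff (degen_ffact lam (Suc m)) (Suc k) / fact m" for m
    by (simp add: fps_degen_ffact_def del: of_nat_Suc)
  show "((1 + fps_const lam * fps_X) * fps_deriv (fps_degen_ffact lam (Suc k))) $ n = fps_degen_ffact lam k $ n"
  proof (cases n)
    case 0
    then show ?thesis
      by (simp add: nth distrib_right mult.assoc coeff_degen_ffact_Suc del: fps_deriv_nth)
         (simp add: fps_degen_ffact_def)
  next
    case (Suc m)
    have "((1 + fps_const lam * fps_X) * fps_deriv (fps_degen_ffact lam (Suc k))) $ n =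
      coeff (degen_ffact lam (Suc n)) (Suc k) / fact n + lam * (coeff (degen_ffact lam n) (Suc k) / fact m)"
      using Suc by (simp add: nth distrib_right mult.assoc del: fact_Suc fps_deriv_nth)
    also have "coeff (degen_ffact lam n) (Suc k) / fact m = of_nat n * coeff (degen_ffact lam n) (Suc k) / fact n"
      using Suc by (simp del: of_nat_Suc)
    finally show ?thesis
      by (simp add: fps_degen_ffact_def coeff_degen_ffact_Suc diff_divide_distrib algebra_simps)
  qed
qed

text \<open>Induction on k: by the two differential equations the derivatives agree after
  multiplication by the nonzero series 1 + \<open>lam\<close> X, which cancels. For k + 1 both
  constant terms are 0.\<close>

lemma fps_degen_log_power: "fps_degen_log lam ^ k = fps_const (fact k) * fps_degen_ffact lam k"
proof (induction k)
  case 0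
  show ?case
    by (rule fps_ext) (simp add: fps_degen_ffact_def coeff_degen_ffact_0)
next
  case (Suc k)
  let ?u = "1 + fps_const lam * fps_X"
  have "?u $ 0 = 1" by simp
  then have u: "?u \<noteq> 0" by (metis fps_zero_nth zero_neq_one)
  have "?u * fps_deriv (fps_degen_log lam ^ Suc k) =
      fps_const (of_nat (Suc k)) * fps_degen_log lam ^ k * (?u * fps_deriv (fps_degen_log lam))"
    by (simp add: fps_deriv_power mult_ac del: of_nat_Suc power_Suc)
  also have "\<dots> = fps_const (of_nat (Suc k)) * fps_degen_log lam ^ k"
    by (simp only: fps_deriv_degen_log mult_1_right)
  also have "\<dots> = fps_const (fact (Suc k)) * fps_degen_ffact lam k"
    unfolding Suc by (simp add: mult.assoc[symmetric] del: of_nat_Suc)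
  also have "\<dots> = ?u * fps_deriv (fps_const (fact (Suc k)) * fps_degen_ffact lam (Suc k))"
    unfolding fps_deriv_degen_ffact[of lam k, symmetric] by (simp add: mult_ac del: fact_Suc)
  finally have "fps_deriv (fps_degen_log lam ^ Suc k) = fps_deriv (fps_const (fact (Suc k)) * fps_degen_ffact lam (Suc k))"
    using u by (simp del: fact_Suc power_Suc)
  then show ?case
    unfolding fps_deriv_eq_iff by (simp add: fps_degen_log_def fps_degen_ffact_def)
qed

section \<open>From formal to convergent power series\<close>

lemma fps_eval_mult:
  fixes t :: "'a::complete_valued_field"
  assumes "(\<lambda>n. A $ n * t ^ n) sums a" "(\<lambda>n. B $ n * t ^ n) sums b"
  shows "(\<lambda>n. (A * B) $ n * t ^ n) sums (a * b)"
proof -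
  have "(\<Sum>i\<le>n. A $ i * t ^ i * (B $ (n - i) * t ^ (n - i))) = (A * B) $ n * t ^ n" for n
    unfolding fps_mult_nth sum_distrib_right atLeast0AtMost
    by (intro sum.cong refl) (simp add: power_add[symmetric] mult_ac)
  with Cauchy_product_vsums[OF assms] show ?thesis
    by simp
qed

lemma fps_eval_power:
  fixes t :: "'a::complete_valued_field"
  assumes "(\<lambda>n. A $ n * t ^ n) sums a"
  shows "(\<lambda>n. (A ^ k) $ n * t ^ n) sums (a ^ k)"
proof (induction k)
  case 0
  show ?case
    using sums_finite[of "{0}" "\<lambda>n. (1 :: 'a fps) $ n * t ^ n"] by simp
next
  case (Suc k)
  then show ?case
    using fps_eval_mult[OF assms] by simp
qed

text \<open>Integers have absolute value at most 1, so each linear factor costs at most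
  \<open>max 1 (vabs lam)\<close>. Multiplied by |t|^m the bound becomes max(|t|,
  |\<open>lam\<close> t|)^m, whence the two conditions on t later.\<close>

lemma vabs_coeff_degen_ffact_le:
  "vabs (coeff (degen_ffact lam m) k) \<le> max 1 (vabs lam) ^ m"
proof (induction m arbitrary: k)
  case 0
  show ?case by simp
next
  case (Suc m)
  let ?M = "max 1 (vabs lam)"
  have 1: "vabs (of_nat m * lam * c) \<le> ?M ^ Suc m" if "vabs c \<le> ?M ^ m" for c
  proof -
    have "vabs (of_nat m * lam) \<le> 1 * ?M"
      unfolding vabs_mult using vabs_of_nat_le_1[of m, where 'a='a] by (intro mult_mono) auto
    then show ?thesis
      using that unfolding vabs_mult[of _ c] by (auto intro!: mult_mono)
  qed
  have 2: "vabs c \<le> ?M ^ Suc m" if "vabs c \<le> ?M ^ m" for c :: 'a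
    by (rule order_trans[OF that]) (rule power_increasing, auto)
  show ?case
  proof (cases k)
    case 0
    then show ?thesis by (simp add: coeff_degen_ffact_0)
  next
    case (Suc l)
    show ?thesis
      unfolding Suc coeff_degen_ffact_Suc by (intro vabs_diff_le 1 2 Suc.IH)
  qed
qed

context padic_valuation
begin

lemma degen_log_power_sums:
  fixes t lam :: 'a
  assumes "lam \<noteq> 0" "vabs (lam * t) < radius"
  shows "(\<lambda>m. coeff (degen_ffact lam m) k / fact m * t ^ m) sums ((vlog (1 + lam * t) / lam) ^ k / fact k)"
proof -
  let ?u = "vlog (1 + lam * t) / lam"
  have "(\<lambda>n. 1 / lam * ((-1) ^ n * (lam * t) ^ Suc n / of_nat (Suc n))) sums (1 / lam * vlog (1 + lam * t))"
    using assms by (intro sums_vmult_left vlog_sums)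
  also have "(\<lambda>n. 1 / lam * ((-1) ^ n * (lam * t) ^ Suc n / of_nat (Suc n))) =
      (\<lambda>n. fps_degen_log lam $ (n + 1) * t ^ (n + 1))"
  proof
    fix n
    have "(- lam) ^ n = (-1) ^ n * lam ^ n"
      by (metis mult_minus1 power_mult_distrib)
    then show "1 / lam * ((-1) ^ n * (lam * t) ^ Suc n / of_nat (Suc n)) = fps_degen_log lam $ (n + 1) * t ^ (n + 1)"
      using assms(1) by (simp add: fps_degen_log_def power_mult_distrib del: of_nat_Suc)
  qed
  finally have "(\<lambda>n. fps_degen_log lam $ n * t ^ n) sums ?u"
    using vsums_shift_iff[of "\<lambda>n. fps_degen_log lam $ n * t ^ n" 1 ?u]
    by (simp add: fps_degen_log_def)
  then have "(\<lambda>n. (fps_degen_log lam ^ k) $ n * t ^ n) sums (?u ^ k)"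
    by (rule fps_eval_power)
  then have "(\<lambda>n. (fps_const (fact k) * fps_degen_ffact lam k) $ n * t ^ n) sums (?u ^ k)"
    by (simp only: fps_degen_log_power)
  from sums_vmult_left[OF this, of "1 / fact k"] show ?thesis
    by (simp add: fps_degen_ffact_def)
qed

text \<open>
  Both sides are the sum of $\gamma_k s_{m,k} t^m/m!$ over all $k$ and $m$, where $s_{m,k}$ are the
  coefficients of the degenerate falling factorials.
\<close>

lemma degen_log_series_sums:
  fixes t lam :: 'a
  assumes lam: "lam \<noteq> 0" "vabs (lam * t) < radius" and t: "vabs t < radius"
    and \<gamma>: "\<And>k. vabs (\<gamma> k) \<le> M"
  shows "(\<lambda>m. (\<Sum>k\<le>m. \<gamma> k * coeff (degen_ffact lam m) k) * t ^ m / fact m) sums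
    (\<Sum>k. (vlog (1 + lam * t) / lam) ^ k / fact k * \<gamma> k)"
proof -
  define f where "f = (\<lambda>k m. \<gamma> k * (coeff (degen_ffact lam m) k / fact m * t ^ m))"
  define \<rho> where "\<rho> = max (vabs t) (vabs (lam * t))"
  have \<rho>: "0 \<le> \<rho>" "\<rho> < radius"
    using lam t by (auto simp: \<rho>_def le_max_iff_disj)
  have M: "0 \<le> M"
    using order_trans[OF vabs_nonneg \<gamma>] .
  have le: "vabs (f k m) \<le> M * (\<rho> ^ m / vabs (fact m :: 'a))" for k m
  proof -
    have "max 1 (vabs lam) ^ m * vabs t ^ m = \<rho> ^ m"
      unfolding power_mult_distrib[symmetric] \<rho>_def
      by (simp add: vabs_mult max_mult_distrib_right)
    moreover have "vabs (coeff (degen_ffact lam m) k) * vabs t ^ m \<le> max 1 (vabs lam) ^ m * vabs t ^ m"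
      by (intro mult_right_mono vabs_coeff_degen_ffact_le) auto
    ultimately have "vabs (coeff (degen_ffact lam m) k) * vabs t ^ m / vabs (fact m :: 'a) \<le> \<rho> ^ m / vabs (fact m :: 'a)"
      by (intro divide_right_mono) auto
    then have "vabs (\<gamma> k) * (vabs (coeff (degen_ffact lam m) k) * vabs t ^ m / vabs (fact m :: 'a)) \<le> M * (\<rho> ^ m / vabs (fact m :: 'a))"
      using \<gamma> M by (intro mult_mono) auto
    then show ?thesis
      by (simp add: f_def vabs_mult vabs_divide vabs_power)
  qed
  have "null_family f"
    unfolding null_family_def
  proof (intro allI impI)
    fix e :: real assume "e > 0"
    have "(\<lambda>m. M * (\<rho> ^ m / vabs (fact m :: 'a))) \<longlonglongrightarrow> M * 0"
      using \<rho> by (intro tendsto_mult tendsto_const power_div_vabs_fact_LIMSEQ)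
    then have "eventually (\<lambda>m. M * (\<rho> ^ m / vabs (fact m :: 'a)) < e) sequentially"
      using \<open>e > 0\<close> by (intro order_tendstoD(2)[of _ "M * 0"]) auto
    then obtain n where n: "\<And>m. m \<ge> n \<Longrightarrow> M * (\<rho> ^ m / vabs (fact m :: 'a)) < e"
      by (auto simp: eventually_sequentially)
    \<comment> \<open>For large m the decay of \<rho>^m/m! suffices; for large k and small m the
      coefficient is 0, because the degree is at most m.\<close>
    have "vabs (f k m) < e" if "n \<le> k \<or> n \<le> m" for k m
    proof (cases "n \<le> m")
      case True
      then show ?thesis using le[of k m] n[of m] by simp
    next
      case False
      then show ?thesis using that \<open>e > 0\<close> by (simp add: f_def coeff_degen_ffact_eq_0)
    qed
    then show "\<exists>n. \<forall>i j. n \<le> i \<or> n \<le> j \<longrightarrow> vabs (f i j) < e"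
      by blast
  qed
  moreover have "f k sums (\<gamma> k * ((vlog (1 + lam * t) / lam) ^ k / fact k))" for k
    unfolding f_def by (intro sums_vmult_left degen_log_power_sums lam)
  moreover have "(\<lambda>k. f k m) sums (\<Sum>k\<le>m. f k m)" for m
    by (rule sums_finite) (auto simp: f_def coeff_degen_ffact_eq_0)
  ultimately have "(\<lambda>m. \<Sum>k\<le>m. f k m) sums (\<Sum>k. \<gamma> k * ((vlog (1 + lam * t) / lam) ^ k / fact k))"
    by (rule null_family_sums_cols)
  moreover have "(\<Sum>k\<le>m. f k m) = (\<Sum>k\<le>m. \<gamma> k * coeff (degen_ffact lam m) k) * t ^ m / fact m" for m
    unfolding f_def sum_distrib_right sum_divide_distrib by (intro sum.cong refl) simp
  ultimately show ?thesis
    by (simp add: mult.commute)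
qed

text \<open>Take \<open>lam\<close> = 1 and all \<gamma>_k = 1: the m-th coefficient becomes the
  falling factorial 1 (1 - 1) (1 - 2) ..., which vanishes for m >= 2 and leaves 1 + z.\<close>

lemma vexp_vlog:
  fixes z :: 'a
  assumes "vabs z < radius"
  shows "vexp (vlog (1 + z)) = 1 + z"
proof -
  have "(\<Sum>k\<le>m. coeff (degen_ffact (1 :: 'a) m) k) = (if m \<le> 1 then 1 else 0)" for m
  proof -
    have "(\<Sum>k\<le>m. coeff (degen_ffact (1 :: 'a) m) k) = (\<Sum>k\<le>degree (degen_ffact (1 :: 'a) m). coeff (degen_ffact (1 :: 'a) m) k)"
      using degree_degen_ffact_le[of "1 :: 'a" m] by (intro sum.mono_neutral_right) (auto simp: coeff_eq_0)
    also have "\<dots> = poly (degen_ffact 1 m) 1"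
      by (simp add: poly_altdef)
    also have "\<dots> = (\<Prod>i<m. 1 - of_nat i)"
      by (simp add: degen_ffact_def poly_prod)
    also have "\<dots> = (if m \<le> 1 then 1 else 0)"
    proof (cases "m \<le> 1")
      case True
      then show ?thesis by (cases m) auto
    next
      case False
      then show ?thesis by (auto intro!: bexI[of _ 1])
    qed
    finally show ?thesis .
  qed
  then have "(\<lambda>m. (if m \<le> 1 then 1 else 0) * z ^ m / fact m) sums vexp (vlog (1 + z))"
    using degen_log_series_sums[of 1 z "\<lambda>_. 1" 1] assms by (simp add: vexp_def)
  moreover have "(\<lambda>m. (if m \<le> 1 then 1 else 0) * z ^ m / fact m) sums (\<Sum>m\<in>{0,1}. (if m \<le> 1 then 1 else 0) * z ^ m / fact m)"
    by (rule sums_finite) auto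
  ultimately show ?thesis
    by (auto dest: sums_unique2)
qed

end

section \<open>$q$-numbers of natural numbers\<close>

text \<open>Free of division, so that q = 1 needs no separate treatment here.\<close>

definition q_nat :: "'a::comm_ring_1 \<Rightarrow> nat \<Rightarrow> 'a" where
  "q_nat q n = (\<Sum>i<n. q ^ i)"

lemma q_nat_0 [simp]: "q_nat q 0 = 0"
  and q_nat_Suc: "q_nat q (Suc n) = q_nat q n + q ^ n"
  by (simp_all add: q_nat_def)

lemma q_nat_1 [simp]: "q_nat q (Suc 0) = 1"
  by (simp add: q_nat_Suc)

lemma q_nat_add: "q_nat q (a + b) = q_nat q a + q ^ a * q_nat q b"
  by (induction b) (simp_all add: q_nat_Suc power_add algebra_simps)

lemma q_nat_mult: "q_nat q (a * b) = q_nat q a * q_nat (q ^ a) b"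
proof (induction b)
  case (Suc b)
  have "q_nat q (a * Suc b) = q_nat q (a * b) + q ^ (a * b) * q_nat q a"
    by (metis mult_Suc_right add.commute q_nat_add)
  then show ?case
    by (simp add: Suc q_nat_Suc power_mult algebra_simps)
qed simp

lemma power_eq_q_nat: "q ^ n = 1 + (q - 1) * q_nat q n"
  by (simp add: q_nat_def flip: power_diff_1_eq)

text \<open>
  Summing $[y+1]^{j+1} - [y]^{j+1}$ over \<open>y\<close>; the summand is $q^y$ times a polynomial in $[y]$
  with leading coefficient $[j+1]$, so the sums of lower powers determine those of $[y]^j$.
\<close>

lemma q_nat_power_telescope:
  "q_nat q n ^ Suc j =
     q_nat q (Suc j) * (\<Sum>y<n. q_nat q y ^ j * q ^ y) +
     (\<Sum>i\<le>j. \<Sum>l<i. of_nat (i choose l) * q ^ l * (\<Sum>y<n. q_nat q y ^ (l + (j - i)) * q ^ y))"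
proof (induction n)
  case 0
  show ?case by simp
next
  case (Suc n)
  let ?Z = "q_nat q n"
  \<comment> \<open>By [n+1] = q [n] + 1. The top term l = i is q^i [n]^j; over all i \<le> j these
    collect the factor [j+1].\<close>
  have expand: "?Z ^ (j - i) * q_nat q (Suc n) ^ i =
      q ^ i * ?Z ^ j + (\<Sum>l<i. of_nat (i choose l) * q ^ l * ?Z ^ (l + (j - i)))" if "i \<le> j" for i
  proof -
    have "q_nat q (Suc n) = q * ?Z + 1"
      using q_nat_add[of q 1 n] by simp
    then have "q_nat q (Suc n) ^ i = (\<Sum>l\<le>i. of_nat (i choose l) * (q * ?Z) ^ l)"
      by (simp add: binomial_ring)
    then have "?Z ^ (j - i) * q_nat q (Suc n) ^ i = (\<Sum>l\<le>i. of_nat (i choose l) * q ^ l * ?Z ^ (l + (j - i)))"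
      by (simp add: sum_distrib_left power_mult_distrib power_add mult_ac)
    then show ?thesis
      using that by (simp add: sum.lessThan_Suc flip: lessThan_Suc_atMost)
  qed
  have "q_nat q (Suc n) ^ Suc j - ?Z ^ Suc j = q ^ n * (\<Sum>i<Suc j. ?Z ^ (j - i) * q_nat q (Suc n) ^ i)"
    using power_diff_sumr2[of "q_nat q (Suc n)" "Suc j" ?Z] by (simp add: q_nat_Suc)
  also have "\<dots> = q ^ n * (\<Sum>i\<le>j. q ^ i * ?Z ^ j + (\<Sum>l<i. of_nat (i choose l) * q ^ l * ?Z ^ (l + (j - i))))"
    unfolding lessThan_Suc_atMost by (simp add: expand)
  also have "\<dots> = q_nat q (Suc j) * (?Z ^ j * q ^ n) +
      (\<Sum>i\<le>j. \<Sum>l<i. of_nat (i choose l) * q ^ l * (?Z ^ (l + (j - i)) * q ^ n))"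
    by (simp add: q_nat_def lessThan_Suc_atMost sum.distrib sum_distrib_left sum_distrib_right algebra_simps
        del: sum.lessThan_Suc sum.atMost_Suc)
  finally have "q_nat q (Suc n) ^ Suc j = ?Z ^ Suc j + \<dots>"
    by (simp add: algebra_simps)
  also have "\<dots> = q_nat q (Suc j) * (\<Sum>y<Suc n. q_nat q y ^ j * q ^ y) +
     (\<Sum>i\<le>j. \<Sum>l<i. of_nat (i choose l) * q ^ l * (\<Sum>y<Suc n. q_nat q y ^ (l + (j - i)) * q ^ y))"
    unfolding Suc.IH by (simp only: sum.lessThan_Suc distrib_left sum.distrib add_ac)
  finally show ?case .
qed

text \<open>The Lipschitz constant of the power map on the unit ball is 1 for every exponent; this
  is the source of the uniformity in j.\<close>

lemma vabs_power_diff_le: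
  assumes "vabs a \<le> 1" "vabs b \<le> 1"
  shows "vabs (a ^ n - b ^ n) \<le> vabs (a - b)"
proof (induction n)
  case (Suc n)
  have "a ^ Suc n - b ^ Suc n = a * (a ^ n - b ^ n) + (a - b) * b ^ n"
    by (simp add: algebra_simps)
  moreover have "vabs a * vabs (a ^ n - b ^ n) \<le> 1 * vabs (a - b)"
    using assms Suc by (intro mult_mono) auto
  moreover have "vabs (a - b) * vabs (b ^ n) \<le> vabs (a - b) * 1"
    using assms by (intro mult_left_mono) (auto simp: vabs_power power_le_one)
  ultimately show ?case
    by (simp add: vabs_add_le vabs_mult)
qed simp

section \<open>The p-adic size of q-numbers\<close>

context padic_valuation
begin

lemma vabs_le_1:
  fixes q :: 'a
  assumes "vabs (q - 1) < radius"
  shows "vabs q \<le> 1"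
  using vabs_add_le[of 1 1 "q - 1"] assms radius_less_1 by simp

lemma vabs_q_nat_le_1:
  assumes "vabs q \<le> 1"
  shows "vabs (q_nat q n) \<le> 1"
  unfolding q_nat_def using assms by (intro vabs_sum_le) (auto simp: vabs_power power_le_one)

lemma vabs_power_minus_1_le:
  fixes q :: 'a
  assumes "vabs (q - 1) < radius"
  shows "vabs (q ^ n - 1) \<le> vabs (q - 1)"
  using vabs_q_nat_le_1[OF vabs_le_1[OF assms], of n]
  by (simp add: power_eq_q_nat vabs_mult mult_left_le)

text \<open>With z = q - 1, [p] - p is the sum of the binomial terms (p choose j) z^(j-1) for 2
  \<le> j \<le> p. For j < p the prime divides the coefficient and the term is at most |z|/p; for j
  = p it is |z|^(p-1) < 1/p by the choice of the radius. So p dominates.\<close>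

lemma vabs_q_nat_p:
  fixes q :: 'a
  assumes "vabs (q - 1) < radius"
  shows "vabs (q_nat q p) = 1 / real p"
proof (cases "q = 1")
  case True
  then show ?thesis by (simp add: q_nat_def vabs_p)
next
  case False
  define z where "z = q - 1"
  have z: "z \<noteq> 0" "vabs z < radius"
    using False assms by (auto simp: z_def)
  have z1: "vabs z < 1"
    using z radius_less_1 by simp
  define M where "M = max (1 / real p * vabs z) (vabs z ^ (p - 1))"
  have "z * q_nat q p = (z + 1) ^ p - 1"
    by (simp add: power_eq_q_nat z_def)
  also have "(z + 1) ^ p = (\<Sum>j\<le>p. of_nat (p choose j) * z ^ j)"
    by (simp add: binomial_ring)
  also have "{..p} = insert 0 (insert 1 {2..p})"
    using p_gt_1 by auto
  finally have "z * (q_nat q p - of_nat p) = (\<Sum>j\<in>{2..p}. of_nat (p choose j) * z ^ j)"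
    by (simp add: algebra_simps)
  also have "vabs \<dots> \<le> vabs z * M"
  proof (intro vabs_sum_le)
    fix j assume j: "j \<in> {2..p}"
    have "vabs (of_nat (p choose j) :: 'a) * vabs z ^ j \<le> vabs z * M"
    proof (cases "j = p")
      case True
      have "vabs z ^ p = vabs z * vabs z ^ (p - 1)"
        using p_gt_1 by (simp add: power_eq_if)
      also have "\<dots> \<le> vabs z * M"
        by (intro mult_left_mono) (auto simp: M_def)
      finally show ?thesis
        using True by simp
    next
      case False
      then have "p dvd (p choose j)"
        using j prime_p by (intro dvd_choose_prime) auto
      then have "vabs (of_nat (p choose j) :: 'a) * vabs z ^ j \<le> 1 / real p * vabs z ^ 2"
        using j z1 by (intro mult_mono vabs_of_nat_dvd power_decreasing) auto
      also have "\<dots> = vabs z * (1 / real p * vabs z)"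
        by (simp add: power2_eq_square)
      also have "\<dots> \<le> vabs z * M"
        by (intro mult_left_mono) (auto simp: M_def)
      finally show ?thesis .
    qed
    then show "vabs (of_nat (p choose j) * z ^ j) \<le> vabs z * M"
      by (simp add: vabs_mult vabs_power)
  qed (simp add: M_def le_max_iff_disj)
  finally have "vabs (q_nat q p - of_nat p) \<le> M"
    using z by (simp add: vabs_mult)
  also have "M < 1 / real p"
  proof -
    have "vabs z ^ (p - 1) < radius ^ (p - 1)"
      using z p_gt_1 by (intro power_strict_mono) auto
    moreover have "1 / real p * vabs z < 1 / real p"
      using z1 p_gt_1 by (simp add: field_simps)
    ultimately show ?thesis
      unfolding M_def radius_power by simp
  qed
  finally have "vabs (q_nat q p - of_nat p) < vabs (of_nat p :: 'a)"
    by (simp add: vabs_p)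
  from vabs_add_eq[OF this] show ?thesis
    by (simp add: vabs_p)
qed

text \<open>Each step multiplies by the q-number of p to the base q^(p^N), and this base is still in
  the disc.\<close>

lemma vabs_q_nat_p_power:
  fixes q :: 'a
  assumes "vabs (q - 1) < radius"
  shows "vabs (q_nat q (p ^ N)) = (1 / real p) ^ N"
proof (induction N)
  case (Suc N)
  have "vabs (q ^ p ^ N - 1) < radius"
    using vabs_power_minus_1_le[OF assms] assms by (rule le_less_trans)
  then show ?case
    unfolding power_Suc2 q_nat_mult by (simp add: vabs_mult Suc vabs_q_nat_p)
qed simp

text \<open>Equivalently, no q \<noteq> 1 in the disc is a root of unity. Splitting off the p-part
  of n leaves a factor congruent modulo Q - 1 to an integer u prime to p, hence of absolute value
  1.\<close>

lemma q_nat_nonzero: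
  fixes q :: 'a
  assumes "vabs (q - 1) < radius" "n > 0"
  shows "q_nat q n \<noteq> 0"
proof -
  obtain u where u: "n = p ^ multiplicity p n * u" "\<not> p dvd u"
    using multiplicity_decompose'[of n p] assms(2) prime_p by (metis not_prime_unit gr_implies_not0)
  define Q where "Q = q ^ p ^ multiplicity p n"
  have Q: "vabs (Q - 1) < radius"
    unfolding Q_def using vabs_power_minus_1_le[OF assms(1)] assms(1) by (rule le_less_trans)
  have "vabs (q_nat Q u - of_nat u) = vabs (\<Sum>i<u. Q ^ i - 1)"
    by (simp add: q_nat_def sum_subtractf)
  also have "\<dots> \<le> vabs (Q - 1)"
    using Q by (intro vabs_sum_le vabs_power_minus_1_le) auto
  also have "\<dots> < 1"
    using Q radius_less_1 by simp
  finally have "vabs (q_nat Q u - of_nat u) < vabs (of_nat u :: 'a)"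
    by (simp add: vabs_of_nat_not_dvd u)
  from vabs_add_eq[OF this] have "vabs (q_nat Q u) = 1"
    by (simp add: vabs_of_nat_not_dvd u)
  moreover have "vabs (q_nat q (p ^ multiplicity p n)) \<noteq> 0"
    using p_gt_1 by (simp only: vabs_q_nat_p_power[OF assms(1)]) simp
  ultimately have "vabs (q_nat q (p ^ multiplicity p n * u)) \<noteq> 0"
    unfolding q_nat_mult vabs_mult Q_def by simp
  then show ?thesis
    using u(1) by simp
qed

end

section \<open>The $q$-integral\<close>

lemma sum_lessThan_mult:
  fixes g :: "nat \<Rightarrow> 'a::comm_monoid_add"
  shows "(\<Sum>y<k * n. g y) = (\<Sum>b<n. \<Sum>a<k. g (a + k * b))"
proof (induction n)
  case (Suc n)
  have "(\<Sum>y<m + k. g y) = (\<Sum>y<m. g y) + (\<Sum>a<k. g (a + m))" for m k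
    by (induction k) (simp_all add: add_ac)
  from this[of "k * n" k] show ?case
    by (simp add: Suc add.commute)
qed simp

locale padic_q = padic_valuation p field_type
  for p :: nat and field_type :: "'a::complete_valued_field itself" +
  fixes q :: 'a
  assumes q_near_1: "vabs (q - 1) < radius"
begin

text \<open>The approximant of \<open>q_integral\<close> before the limit, stated through
  \<open>q_nat\<close> to keep exp and log out until \<open>qnum_of_nat\<close>.\<close>

definition q_mean :: "nat \<Rightarrow> (nat \<Rightarrow> 'a) \<Rightarrow> 'a" where
  "q_mean N \<phi> = (\<Sum>y<p ^ N. \<phi> y * q ^ y) / q_nat q (p ^ N)"

lemma q_mean_sum: "q_mean N (\<lambda>y. \<Sum>i\<in>A. \<phi> i y) = (\<Sum>i\<in>A. q_mean N (\<phi> i))"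
  unfolding q_mean_def sum_divide_distrib[symmetric] sum_distrib_right by (subst sum.swap) simp

lemma q_mean_cmult: "q_mean N (\<lambda>y. c * \<phi> y) = c * q_mean N \<phi>"
  unfolding q_mean_def by (simp add: sum_distrib_left mult.assoc)

lemma vabs_q_le_1: "vabs q \<le> 1"
  by (rule vabs_le_1[OF q_near_1])

lemma vabs_q_power_le_1: "vabs (q ^ n) \<le> 1"
  using vabs_q_le_1 by (simp add: vabs_power power_le_one)

text \<open>
  Successive means differ by at most $|[p^N]|/|[p^{N+1}]| = p$, so by the ultrametric inequality
  they stay bounded by \<open>p\<close>.
\<close>

lemma vabs_q_mean_le:
  assumes "\<And>y. vabs (\<phi> y) \<le> 1" "\<And>N a b. vabs (\<phi> (a + p ^ N * b) - \<phi> a) \<le> (1 / real p) ^ N"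
  shows "vabs (q_mean N \<phi>) \<le> real p"
proof (induction N)
  case 0
  have "vabs (q_mean 0 \<phi>) \<le> 1"
    using assms(1)[of 0] by (simp add: q_mean_def)
  then show ?case using p_gt_1 by simp
next
  case (Suc N)
  let ?Q = "q ^ p ^ N" and ?s = "\<Sum>a<p ^ N. \<phi> a * q ^ a"
  \<comment> \<open>D measures how far \<phi> is from having period p^N. For a periodic \<phi> the
    two means would agree exactly, by the factorisation \<open>fac\<close>.\<close>
  define D where "D = (\<Sum>b<p. \<Sum>a<p ^ N. (\<phi> (a + p ^ N * b) - \<phi> a) * q ^ (a + p ^ N * b))"
  have nz: "q_nat q (p ^ N) \<noteq> 0" "q_nat q (p ^ Suc N) \<noteq> 0"
    using q_near_1 p_gt_1 by (intro q_nat_nonzero; simp)+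
  have fac: "q_nat q (p ^ Suc N) = q_nat q (p ^ N) * q_nat ?Q p"
    by (simp only: power_Suc2 q_nat_mult)
  have "(\<Sum>y<p ^ Suc N. \<phi> y * q ^ y) = (\<Sum>b<p. \<Sum>a<p ^ N. \<phi> (a + p ^ N * b) * q ^ (a + p ^ N * b))"
    unfolding power_Suc2 by (rule sum_lessThan_mult)
  also have "\<dots> = D + (\<Sum>b<p. \<Sum>a<p ^ N. \<phi> a * q ^ (a + p ^ N * b))"
    unfolding D_def sum.distrib[symmetric] by (simp add: algebra_simps)
  also have "(\<Sum>b<p. \<Sum>a<p ^ N. \<phi> a * q ^ (a + p ^ N * b)) = ?s * q_nat ?Q p"
    unfolding q_nat_def sum_product power_add power_mult by (subst sum.swap) (simp only: mult.assoc)
  finally have "q_mean (Suc N) \<phi> = (D + ?s * q_nat ?Q p) / q_nat q (p ^ Suc N)"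
    by (simp only: q_mean_def)
  also have "\<dots> = D / q_nat q (p ^ Suc N) + q_mean N \<phi>"
    using nz unfolding fac q_mean_def by (simp add: field_simps)
  finally have eq: "q_mean (Suc N) \<phi> = D / q_nat q (p ^ Suc N) + q_mean N \<phi>" .
  have "vabs D \<le> (1 / real p) ^ N"
    unfolding D_def
  proof (intro vabs_sum_le)
    fix a b
    have "vabs (\<phi> (a + p ^ N * b) - \<phi> a) * vabs (q ^ (a + p ^ N * b)) \<le> (1 / real p) ^ N * 1"
      by (intro mult_mono assms(2) vabs_q_power_le_1) auto
    then show "vabs ((\<phi> (a + p ^ N * b) - \<phi> a) * q ^ (a + p ^ N * b)) \<le> (1 / real p) ^ N"
      by (simp add: vabs_mult)
  qed auto
  then have "vabs (D / q_nat q (p ^ Suc N)) \<le> real p"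
    using p_gt_1 unfolding vabs_divide vabs_q_nat_p_power[OF q_near_1] by (simp add: field_simps)
  then show ?case
    unfolding eq using Suc by (rule vabs_add_le)
qed

text \<open>The difference [a + p^N b] - [a] contains the factor [p^N] of size p^(-N), and passing
  to j-th powers does not enlarge it.\<close>

lemma vabs_q_mean_power_le: "vabs (q_mean N (\<lambda>y. q_nat q y ^ j)) \<le> real p"
proof (rule vabs_q_mean_le)
  fix y show "vabs (q_nat q y ^ j) \<le> 1"
    using vabs_q_nat_le_1[OF vabs_q_le_1] by (simp add: vabs_power power_le_one)
next
  fix N a b
  have "vabs (q_nat q (a + p ^ N * b) ^ j - q_nat q a ^ j) \<le> vabs (q_nat q (a + p ^ N * b) - q_nat q a)"
    by (intro vabs_power_diff_le vabs_q_nat_le_1 vabs_q_le_1)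
  also have "\<dots> = (1 / real p) ^ N * (vabs (q ^ a) * vabs (q_nat (q ^ p ^ N) b))"
    by (simp add: q_nat_add q_nat_mult vabs_mult vabs_q_nat_p_power[OF q_near_1])
  also have "vabs (q ^ a) * vabs (q_nat (q ^ p ^ N) b) \<le> 1 * 1"
    by (intro mult_mono vabs_q_power_le_1 vabs_q_nat_le_1) auto
  finally show "vabs (q_nat q (a + p ^ N * b) ^ j - q_nat q a ^ j) \<le> (1 / real p) ^ N"
    by (simp add: mult_left_mono)
qed

lemma q_nat_p_power_LIMSEQ: "(\<lambda>N. q_nat q (p ^ N)) \<longlonglongrightarrow> 0"
  unfolding tendsto_0_iff_vabs vabs_q_nat_p_power[OF q_near_1]
  using p_gt_1 by (intro LIMSEQ_power_zero) simp

text \<open>Put n = p^N in the telescoped identity and divide by [p^N]. The exponents l + (j - i)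
  with l < i are below j, so induction applies, and [j+1] \<noteq> 0 allows solving for the j-th
  mean.\<close>

lemma q_mean_power_convergent: "convergent (\<lambda>N. q_mean N (\<lambda>y. q_nat q y ^ j))"
proof (induction j rule: less_induct)
  case (less j)
  then obtain L where L: "\<And>i. i < j \<Longrightarrow> (\<lambda>N. q_mean N (\<lambda>y. q_nat q y ^ i)) \<longlonglongrightarrow> L i"
    unfolding convergent_def by metis
  have nz: "q_nat q (Suc j) \<noteq> 0" "q_nat q (p ^ N) \<noteq> 0" for N
    using q_near_1 p_gt_1 by (intro q_nat_nonzero; simp)+
  define E where "E = (\<lambda>N. \<Sum>i\<le>j. \<Sum>l<i. of_nat (i choose l) * q ^ l * q_mean N (\<lambda>y. q_nat q y ^ (l + (j - i))))"
  have "q_nat q (p ^ N) ^ j = q_nat q (Suc j) * q_mean N (\<lambda>y. q_nat q y ^ j) + E N" for N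
  proof -
    have mean: "(\<Sum>y<p ^ N. \<phi> y * q ^ y) = q_nat q (p ^ N) * q_mean N \<phi>" for \<phi>
      using nz by (simp add: q_mean_def)
    have "q_nat q (p ^ N) ^ Suc j = q_nat q (p ^ N) * (q_nat q (Suc j) * q_mean N (\<lambda>y. q_nat q y ^ j) + E N)"
      unfolding q_nat_power_telescope mean E_def by (simp only: sum_distrib_left distrib_left mult.left_commute)
    then show ?thesis
      using nz by simp
  qed
  then have eq: "q_mean N (\<lambda>y. q_nat q y ^ j) = 1 / q_nat q (Suc j) * (q_nat q (p ^ N) ^ j - E N)" for N
    using nz by (simp add: field_simps)
  have E: "E \<longlonglongrightarrow> (\<Sum>i\<le>j. \<Sum>l<i. of_nat (i choose l) * q ^ l * L (l + (j - i)))"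
    unfolding E_def by (intro tendsto_sum tendsto_vmult_left L) auto
  \<comment> \<open>The limit is written as a power to include j = 0, where it is 1.\<close>
  have "(\<lambda>N. q_nat q (p ^ N) ^ j) \<longlonglongrightarrow> 0 ^ j"
  proof (cases j)
    case (Suc i)
    have "(\<lambda>N. q_nat q (p ^ N) ^ j) \<longlonglongrightarrow> 0"
    proof (rule LIMSEQ_0_vabs_le)
      show "vabs (q_nat q (p ^ N) ^ j) \<le> vabs (q_nat q (p ^ N))" for N
        using vabs_power_diff_le[OF vabs_q_nat_le_1[OF vabs_q_le_1, of "p ^ N"], of 0 j] Suc by simp
      show "(\<lambda>N. vabs (q_nat q (p ^ N))) \<longlonglongrightarrow> 0"
        using q_nat_p_power_LIMSEQ by (simp add: tendsto_0_iff_vabs[of "\<lambda>N. q_nat q (p ^ N)"])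
    qed
    then show ?thesis using Suc by simp
  qed simp
  from tendsto_vmult_left[OF tendsto_diff[OF this E]] show ?case
    unfolding eq by (rule convergentI)
qed

text \<open>The Carlitz number of order one, that is, the value at x = 0.\<close>

definition q_moment :: "nat \<Rightarrow> 'a" where
  "q_moment j = lim (\<lambda>N. q_mean N (\<lambda>y. q_nat q y ^ j))"

lemma q_moment_LIMSEQ: "(\<lambda>N. q_mean N (\<lambda>y. q_nat q y ^ j)) \<longlonglongrightarrow> q_moment j"
  unfolding q_moment_def using q_mean_power_convergent by (simp add: convergent_LIMSEQ_iff)

lemma vabs_q_moment_le: "vabs (q_moment j) \<le> real p"
  using q_moment_LIMSEQ vabs_q_mean_power_le by (rule vabs_limit_le)

end

section \<open>Iterated $q$-integrals of power series in $[x_1 + \cdots + x_r + x]_q$\<close>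

text \<open>A bound on the Gauss norm, which is submultiplicative and bounds the values on the unit
  ball.\<close>

definition coeffs_le :: "real \<Rightarrow> 'a::complete_valued_field poly \<Rightarrow> bool" where
  "coeffs_le M P \<longleftrightarrow> (\<forall>i. vabs (coeff P i) \<le> M)"

lemma coeffs_le_sum:
  "(\<And>i. i \<in> A \<Longrightarrow> coeffs_le M (P i)) \<Longrightarrow> 0 \<le> M \<Longrightarrow> coeffs_le M (sum P A)"
  unfolding coeffs_le_def coeff_sum by (auto intro: vabs_sum_le)

lemma coeffs_le_smult:
  "vabs c \<le> K \<Longrightarrow> coeffs_le M P \<Longrightarrow> coeffs_le (K * M) (smult c P)"
  unfolding coeffs_le_def coeff_smult vabs_mult
  using order_trans[OF vabs_nonneg, of c K] by (auto intro!: mult_mono)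

lemma coeffs_le_nonneg: "coeffs_le M P \<Longrightarrow> 0 \<le> M"
  unfolding coeffs_le_def using order_trans[OF vabs_nonneg] by blast

lemma coeffs_le_mult:
  assumes "coeffs_le K P" "coeffs_le M Q"
  shows "coeffs_le (K * M) (P * Q)"
  using assms coeffs_le_nonneg[OF assms(1)] coeffs_le_nonneg[OF assms(2)]
  unfolding coeffs_le_def coeff_mult by (auto intro!: vabs_sum_le mult_mono simp: vabs_mult)

lemma coeffs_le_monom_1: "coeffs_le 1 (monom 1 n)"
  by (simp add: coeffs_le_def)

lemma coeffs_le_power: "coeffs_le 1 P \<Longrightarrow> coeffs_le 1 (P ^ n)"
proof (induction n)
  case 0
  show ?case by (simp add: coeffs_le_def)
next
  case (Suc n)
  then show ?case using coeffs_le_mult[of 1 P 1 "P ^ n"] by simp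
qed

lemma vabs_poly_le:
  assumes "coeffs_le M P" "vabs X \<le> 1"
  shows "vabs (poly P X) \<le> M"
  unfolding poly_altdef
proof (intro vabs_sum_le coeffs_le_nonneg[OF assms(1)])
  fix i
  have "vabs (coeff P i) * vabs X ^ i \<le> M * 1"
    using assms coeffs_le_nonneg[OF assms(1)] unfolding coeffs_le_def
    by (intro mult_mono) (auto simp: power_le_one)
  then show "vabs (coeff P i * X ^ i) \<le> M"
    by (simp add: vabs_mult vabs_power)
qed

context padic_q
begin

text \<open>
  \<open>umbral m P\<close> arises from $P(X + Y (1 + (q - 1) X))$ by replacing each $Y^j$ with $m_j$. Since
  $[y + x] = [x] + [y] (1 + (q - 1) [x])$, integrating $P([y + x])$ over \<open>y\<close> amounts to
  replacing $[y]^j$ by its integral.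
\<close>

definition umbral :: "(nat \<Rightarrow> 'a) \<Rightarrow> 'a poly \<Rightarrow> 'a poly" where
  "umbral m P = (\<Sum>i\<le>degree P. smult (coeff P i)
     (\<Sum>j\<le>i. smult (m j) (smult (of_nat (i choose j)) (monom 1 (i - j) * [:1, q - 1:] ^ j))))"

lemma poly_umbral:
  "poly (umbral m P) X = (\<Sum>i\<le>degree P. coeff P i *
     (\<Sum>j\<le>i. m j * (of_nat (i choose j) * (X ^ (i - j) * (1 + X * (q - 1)) ^ j))))"
  by (simp add: umbral_def poly_sum poly_monom poly_power mult.assoc)

text \<open>Binomial coefficients and the coefficients of 1 + (q - 1) X have size at most 1, so the
  substitution costs only the bound K on the moments, whatever the degree.\<close>

lemma coeffs_le_umbral:
  assumes "coeffs_le M P" "\<And>j. vabs (m j) \<le> K"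
  shows "coeffs_le (M * K) (umbral m P)"
proof -
  have M: "0 \<le> M" using assms(1) by (rule coeffs_le_nonneg)
  have K: "0 \<le> K" using order_trans[OF vabs_nonneg assms(2)] .
  have "coeffs_le 1 [:1, q - 1:]"
    using q_near_1 radius_less_1 by (auto simp: coeffs_le_def coeff_pCons split: nat.split)
  then have 1: "coeffs_le (1 * 1) (monom 1 i * [:1, q - 1:] ^ j)" for i j
    by (intro coeffs_le_mult coeffs_le_power coeffs_le_monom_1)
  have "coeffs_le (K * (1 * (1 * 1))) (smult (m j) (smult (of_nat (i choose j)) (monom 1 (i - j) * [:1, q - 1:] ^ j)))" for i j
    by (intro coeffs_le_smult 1 assms(2) vabs_of_nat_le_1)
  then show ?thesis
    unfolding umbral_def using assms(1) K M
    by (intro coeffs_le_sum coeffs_le_smult) (auto simp: coeffs_le_def)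
qed

text \<open>An exact identity at each finite level. The limit and the uniform bound therefore both
  come from \<open>umbral\<close>, with moments or with means as its first argument.\<close>

lemma q_mean_poly:
  "q_mean N (\<lambda>y. poly P (X + q_nat q y * (1 + X * (q - 1)))) =
     poly (umbral (\<lambda>j. q_mean N (\<lambda>y. q_nat q y ^ j)) P) X"
proof -
  have "poly P (X + Y * W) = (\<Sum>i\<le>degree P. coeff P i *
     (\<Sum>j\<le>i. (of_nat (i choose j) * (X ^ (i - j) * W ^ j)) * Y ^ j))" for Y W
    by (simp add: poly_altdef add.commute[of X] binomial_ring power_mult_distrib mult_ac)
  then show ?thesis
    unfolding poly_umbral
    by (simp only: q_mean_sum q_mean_cmult) (simp only: mult.commute[of "q_mean _ _"])
qed

lemma q_mean_poly_LIMSEQ: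
  "(\<lambda>N. q_mean N (\<lambda>y. poly P (X + q_nat q y * (1 + X * (q - 1))))) \<longlonglongrightarrow> poly (umbral q_moment P) X"
proof -
  have "(\<lambda>N. q_mean N (\<lambda>y. q_nat q y ^ j) * c) \<longlonglongrightarrow> q_moment j * c" for j c
    using tendsto_vmult_left[OF q_moment_LIMSEQ, of c j] by (simp add: mult.commute)
  then show ?thesis
    unfolding q_mean_poly poly_umbral by (intro tendsto_sum tendsto_vmult_left)
qed

lemma vabs_q_mean_poly_le:
  assumes "coeffs_le M P" "vabs X \<le> 1"
  shows "vabs (q_mean N (\<lambda>y. poly P (X + q_nat q y * (1 + X * (q - 1))))) \<le> M * real p"
  unfolding q_mean_poly using assms vabs_q_mean_power_le
  by (intro vabs_poly_le coeffs_le_umbral)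

section \<open>q-powers and q-numbers on the unit ball\<close>

lemma vabs_vlog_q: "vabs (vlog q) \<le> vabs (q - 1)"
  using vabs_vlog_le[OF q_near_1] by simp

lemma vabs_mult_vlog_q:
  assumes "vabs x \<le> 1"
  shows "vabs (x * vlog q) \<le> vabs (q - 1)" "vabs (x * vlog q) < radius"
proof -
  have "vabs x * vabs (vlog q) \<le> 1 * vabs (q - 1)"
    using assms vabs_vlog_q by (intro mult_mono) auto
  then show "vabs (x * vlog q) \<le> vabs (q - 1)" "vabs (x * vlog q) < radius"
    using q_near_1 by (auto simp: vabs_mult)
qed

lemma qpow_add:
  assumes "vabs x \<le> 1" "vabs y \<le> 1"
  shows "qpow q (x + y) = qpow q x * qpow q y"
  unfolding qpow_def distrib_right by (intro vexp_add vabs_mult_vlog_q assms)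

lemma qpow_of_nat: "qpow q (of_nat n) = q ^ n"
proof (induction n)
  case 0
  show ?case by (simp add: qpow_def)
next
  case (Suc n)
  have "qpow q (of_nat (Suc n)) = qpow q 1 * qpow q (of_nat n)"
    by (simp add: qpow_add vabs_of_nat_le_1)
  also have "qpow q 1 = q"
    using vexp_vlog[OF q_near_1] by (simp add: qpow_def)
  finally show ?case
    by (simp add: Suc)
qed

lemma qnum_of_nat: "qnum q (of_nat n) = q_nat q n"
proof (cases "q = 1")
  case True
  then show ?thesis by (simp add: qnum_def q_nat_def)
next
  case False
  then show ?thesis
    by (simp add: qnum_def qpow_of_nat power_eq_q_nat[of q n] field_simps)
qed

lemma vabs_qnum_le_1:
  assumes "vabs x \<le> 1"
  shows "vabs (qnum q x) \<le> 1"
proof (cases "q = 1")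
  case True
  then show ?thesis using assms by (simp add: qnum_def)
next
  case False
  have "vabs (qpow q x - 1) \<le> vabs (q - 1)"
    unfolding qpow_def
    by (rule order_trans[OF vabs_vexp_minus_1_le[OF vabs_mult_vlog_q(2)[OF assms]] vabs_mult_vlog_q(1)[OF assms]])
  then show ?thesis
    using False by (simp add: qnum_def vabs_divide vabs_minus_commute[of 1] divide_le_eq)
qed

text \<open>The bracket is q^x, expressed through [x] so that integrating over n stays within
  polynomials in [x].\<close>

lemma qnum_add:
  assumes "vabs x \<le> 1"
  shows "qnum q (of_nat n + x) = qnum q x + q_nat q n * (1 + qnum q x * (q - 1))"
proof (cases "q = 1")
  case True
  then show ?thesis by (simp add: qnum_def q_nat_def)
next
  case False
  have "1 + qnum q x * (q - 1) = qpow q x"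
    using False by (simp add: qnum_def field_simps)
  moreover have "qnum q (of_nat n + x) = qnum q x + q_nat q n * qpow q x"
    using False assms
    by (simp add: qnum_def qpow_add vabs_of_nat_le_1 qpow_of_nat power_eq_q_nat[of q n] field_simps)
  ultimately show ?thesis by simp
qed

definition moment_poly :: "nat \<Rightarrow> nat \<Rightarrow> 'a poly" where
  "moment_poly r k = (umbral q_moment ^^ r) (monom 1 k)"

lemma coeffs_le_moment_poly: "coeffs_le (real p ^ r) (moment_poly r k)"
proof (induction r)
  case 0
  show ?case by (simp add: moment_poly_def coeffs_le_monom_1)
next
  case (Suc r)
  then show ?case
    using coeffs_le_umbral[OF Suc vabs_q_moment_le] by (simp add: moment_poly_def mult.commute)
qed

text \<open>The uniform coefficient bound p^r for \<open>moment_poly\<close> supplies the domination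
  needed to move the outer limit inside the series.\<close>

lemma multi_q_integral_series:
  assumes "vabs x \<le> 1" "c \<longlonglongrightarrow> 0"
  shows "multi_q_integral p q r (\<lambda>ys. \<Sum>k. c k * qnum q (sum_list ys + x) ^ k) =
    (\<Sum>k. c k * poly (moment_poly r k) (qnum q x))"
  using assms(1)
proof (induction r arbitrary: x)
  case 0
  show ?case by (simp add: moment_poly_def poly_monom)
next
  case (Suc r)
  let ?g = "\<lambda>k y. poly (moment_poly r k) (qnum q x + q_nat q y * (1 + qnum q x * (q - 1)))"
  have x: "vabs (qnum q x) \<le> 1"
    using Suc.prems by (rule vabs_qnum_le_1)
  have shift: "vabs (of_nat y + x) \<le> 1" for y
    using Suc.prems by (intro vabs_add_le vabs_of_nat_le_1)
  \<comment> \<open>The outer variable is absorbed into x, which is why the induction is over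
    arbitrary x in the unit ball.\<close>
  have inner: "multi_q_integral p q r (\<lambda>ys. \<Sum>k. c k * qnum q (sum_list (ys @ [of_nat y]) + x) ^ k) = (\<Sum>k. c k * ?g k y)" for y
    using Suc.IH[OF shift, of y] by (simp add: qnum_add[OF Suc.prems] add.assoc)
  have "(\<lambda>k. c k * ?g k y) sums (\<Sum>k. c k * ?g k y)" for y
  proof (intro summable_sums vabs_summable LIMSEQ_0_vmult_bounded[OF assms(2)])
    fix k show "vabs (?g k y) \<le> real p ^ r"
      using vabs_poly_le[OF coeffs_le_moment_poly vabs_qnum_le_1[OF shift]]
      by (simp add: qnum_add[OF Suc.prems])
  qed
  then have interchange: "(\<lambda>k. \<Sum>y<p ^ N. q ^ y / q_nat q (p ^ N) * (c k * ?g k y)) sums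
      (\<Sum>y<p ^ N. q ^ y / q_nat q (p ^ N) * (\<Sum>k. c k * ?g k y))" for N
    by (intro sums_sum sums_vmult_left)
  have terms: "(\<lambda>k. \<Sum>y<p ^ N. q ^ y / q_nat q (p ^ N) * (c k * ?g k y)) = (\<lambda>k. c k * q_mean N (?g k))" for N
    unfolding q_mean_def sum_divide_distrib sum_distrib_left by (simp add: mult_ac)
  have "(\<Sum>k. c k * q_mean N (?g k)) =
      1 / qnum q (of_nat (p ^ N)) * (\<Sum>y<p ^ N. (\<Sum>k. c k * ?g k y) * q ^ y)" for N
    using interchange[of N] unfolding terms qnum_of_nat sum_distrib_left by (simp add: sums_iff mult_ac)
  then have "multi_q_integral p q (Suc r) (\<lambda>ys. \<Sum>k. c k * qnum q (sum_list ys + x) ^ k) =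
      lim (\<lambda>N. \<Sum>k. c k * q_mean N (?g k))"
    by (simp only: multi_q_integral.simps q_integral_def inner)
  also have "(\<lambda>N. \<Sum>k. c k * q_mean N (?g k)) \<longlonglongrightarrow> (\<Sum>k. c k * poly (moment_poly (Suc r) k) (qnum q x))"
  proof (rule vsums_dominated_LIMSEQ[OF assms(2)])
    show "(\<lambda>N. q_mean N (?g k)) \<longlonglongrightarrow> poly (moment_poly (Suc r) k) (qnum q x)" for k
      using q_mean_poly_LIMSEQ by (simp add: moment_poly_def)
    show "vabs (q_mean N (?g k)) \<le> real p ^ r * real p" for N k
      using coeffs_le_moment_poly x by (rule vabs_q_mean_poly_le)
  qed
  then have "lim (\<lambda>N. \<Sum>k. c k * q_mean N (?g k)) = (\<Sum>k. c k * poly (moment_poly (Suc r) k) (qnum q x))"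
    by (rule limI)
  finally show ?case .
qed

lemma carlitz_bernoulli_eq:
  assumes "vabs x \<le> 1"
  shows "carlitz_bernoulli p q r n x = poly (moment_poly r n) (qnum q x)"
proof -
  let ?c = "\<lambda>k. if k = n then 1 else 0 :: 'a"
  have c: "(\<Sum>k. ?c k * z k) = z n" for z
    using suminf_finite[of "{n}" "\<lambda>k. ?c k * z k"] by simp
  have "?c \<longlonglongrightarrow> 0"
    by (rule summable_imp_vabs_LIMSEQ_0) simp
  from multi_q_integral_series[OF assms this] show ?thesis
    by (simp only: carlitz_bernoulli_def c)
qed

lemma vabs_carlitz_bernoulli_le:
  assumes "vabs x \<le> 1"
  shows "vabs (carlitz_bernoulli p q r n x) \<le> real p ^ r"
  unfolding carlitz_bernoulli_eq[OF assms]
  by (intro vabs_poly_le[OF coeffs_le_moment_poly] vabs_qnum_le_1 assms)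

lemma degenerate_generating_function:
  assumes x: "vabs x \<le> 1" and lam: "lam \<noteq> 0" "vabs (lam * t) < radius" and t: "vabs t < radius"
  shows "(\<lambda>m. (\<Sum>k\<le>m. carlitz_bernoulli p q r k x * coeff (degen_ffact lam m) k) * t ^ m / fact m) sums
    multi_q_integral p q r (\<lambda>ys. degenerate_exp lam t (qnum q (sum_list ys + x)))"
proof -
  let ?u = "vlog (1 + lam * t) / lam"
  have "vabs (vlog (1 + lam * t)) \<le> vabs (lam * t)"
    using lam by (intro vabs_vlog_le)
  \<comment> \<open>The factor \<open>lam\<close> cancels, so the condition on t itself makes the
    exponential series converge.\<close>
  then have "vabs ?u \<le> vabs t"
    using lam(1) by (simp add: vabs_divide vabs_mult field_simps)
  then have "(\<lambda>k. ?u ^ k / fact k) \<longlonglongrightarrow> 0"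
    using t by (intro exp_terms_LIMSEQ) simp
  moreover have "degenerate_exp lam t a = (\<Sum>k. ?u ^ k / fact k * a ^ k)" for a
    unfolding degenerate_exp_def vexp_def by (simp add: power_mult_distrib power_divide mult_ac)
  ultimately have "multi_q_integral p q r (\<lambda>ys. degenerate_exp lam t (qnum q (sum_list ys + x))) =
      (\<Sum>k. ?u ^ k / fact k * carlitz_bernoulli p q r k x)"
    by (simp only: multi_q_integral_series[OF x] carlitz_bernoulli_eq[OF x])
  then show ?thesis
    using degen_log_series_sums[OF lam t vabs_carlitz_bernoulli_le[OF x]] by simp
qed

end

section \<open>Uniqueness of the coefficients and inversion\<close>

context padic_valuation
begin

text \<open>An identity theorem from the points t p^s alone. Once the coefficients below m vanish,
  the term of order m equals minus the rest, which carries at least one more factor p^(-s);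
  cancelling p^(-sm) and letting s grow forces it to 0.\<close>

lemma power_series_coeff_eq_0:
  fixes d :: "nat \<Rightarrow> 'a"
  assumes "t \<noteq> 0" and sums: "\<And>s. (\<lambda>m. d m * (t * of_nat p ^ s) ^ m) sums 0"
  shows "d m = 0"
proof (induction m rule: less_induct)
  case (less m)
  have "(\<lambda>k. d k * t ^ k) \<longlonglongrightarrow> 0"
    using sums[of 0] by (intro summable_imp_vabs_LIMSEQ_0) (simp add: sums_summable)
  then obtain B where B: "\<And>k. vabs (d k * t ^ k) \<le> B"
    using LIMSEQ_0_vabs_bounded by metis
  have B0: "0 \<le> B"
    using order_trans[OF vabs_nonneg B] .
  have p: "0 < 1 / real p" "1 / real p < 1"
    using p_gt_1 by auto
  have vabs_term: "vabs (d k * (t * of_nat p ^ s) ^ k) = vabs (d k * t ^ k) * ((1 / real p) ^ s) ^ k" for k s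
    by (simp add: vabs_mult vabs_power vabs_p power_mult_distrib)
  have "vabs (d m * t ^ m) \<le> B * (1 / real p) ^ s" for s
  proof -
    let ?f = "\<lambda>k. d k * (t * of_nat p ^ s) ^ k" and ?c = "(1 / real p) ^ s"
    have c: "0 < ?c" "?c \<le> 1"
      using p by (auto intro: power_le_one)
    have "(\<Sum>k<Suc m. ?f k) = ?f m"
      using less.IH by (simp add: sum.neutral)
    then have "(\<lambda>i. ?f (i + Suc m)) sums (- ?f m)"
      using vsums_shift_iff[of ?f "Suc m" 0] sums[of s] by simp
    then have "vabs (- ?f m) \<le> B * ?c ^ Suc m"
    proof (rule vabs_sums_le)
      fix i
      have "vabs (d (i + Suc m) * t ^ (i + Suc m)) * ?c ^ (i + Suc m) \<le> B * ?c ^ Suc m"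
        using c B0 by (intro mult_mono B power_decreasing) auto
      then show "vabs (?f (i + Suc m)) \<le> B * ?c ^ Suc m"
        unfolding vabs_term .
    qed
    then have "vabs (d m * t ^ m) * ?c ^ m \<le> B * ?c * ?c ^ m"
      unfolding vabs_minus vabs_term by (simp add: mult_ac)
    then show ?thesis
      using c by (simp add: mult_le_cancel_right)
  qed
  moreover have "(\<lambda>s. B * (1 / real p) ^ s) \<longlonglongrightarrow> B * 0"
    using p by (intro tendsto_mult tendsto_const LIMSEQ_power_zero) simp
  ultimately have "vabs (d m * t ^ m) \<le> B * 0"
    by (intro LIMSEQ_le_const) auto
  then have "d m * t ^ m = 0"
    by (metis mult_zero_right order_antisym vabs_eq_0_iff vabs_nonneg)
  then show ?case
    using \<open>t \<noteq> 0\<close> by simp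
qed

lemma egf_coeff_unique:
  fixes b b' :: "nat \<Rightarrow> 'a" and lam :: 'a
  assumes "\<And>t. vabs (lam * t) < radius \<Longrightarrow> vabs t < radius \<Longrightarrow> (\<lambda>m. b m * t ^ m / fact m) sums F t"
    and "\<And>t. vabs (lam * t) < radius \<Longrightarrow> vabs t < radius \<Longrightarrow> (\<lambda>m. b' m * t ^ m / fact m) sums F t"
  shows "b = b'"
proof
  fix m
  have "0 < radius / max 1 (vabs lam)"
    using radius_pos by simp
  \<comment> \<open>The divisor \<open>max 1 (vabs lam)\<close> makes p^k, and every higher power of
    p, satisfy both conditions on t.\<close>
  then obtain k where k: "(1 / real p) ^ k < radius / max 1 (vabs lam)"
    using real_arch_pow_inv[of _ "1 / real p"] p_gt_1 by auto
  have small: "vabs (lam * of_nat p ^ j) < radius" "vabs (of_nat p ^ j :: 'a) < radius" if "k \<le> j" for j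
  proof -
    have "(1 / real p) ^ j \<le> (1 / real p) ^ k"
      using that p_gt_1 by (intro power_decreasing) auto
    also note k
    finally have *: "(1 / real p) ^ j * max 1 (vabs lam) < radius"
      by (subst (asm) pos_less_divide_eq) auto
    have "(1 / real p) ^ j * vabs lam \<le> (1 / real p) ^ j * max 1 (vabs lam)"
        "(1 / real p) ^ j * 1 \<le> (1 / real p) ^ j * max 1 (vabs lam)"
      by (intro mult_left_mono; simp)+
    with * show "vabs (lam * of_nat p ^ j) < radius" "vabs (of_nat p ^ j :: 'a) < radius"
      by (simp_all add: vabs_mult vabs_power vabs_p mult.commute)
  qed
  have "(b m - b' m) / fact m = 0"
  proof (rule power_series_coeff_eq_0)
    show "(of_nat p ^ k :: 'a) \<noteq> 0"
      using p_gt_1 by simp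
    fix s
    have "(\<lambda>m. b m * (of_nat p ^ (k + s)) ^ m / fact m - b' m * (of_nat p ^ (k + s)) ^ m / fact m) sums
        (F (of_nat p ^ (k + s)) - F (of_nat p ^ (k + s)))"
      unfolding sums_def sum_subtractf
      by (intro tendsto_diff) (intro assms[unfolded sums_def] small le_add1)+
    then show "(\<lambda>m. (b m - b' m) / fact m * (of_nat p ^ k * of_nat p ^ s) ^ m) sums 0"
      by (simp add: power_add diff_divide_distrib left_diff_distrib)
  qed
  then show "b m = b' m"
    by simp
qed

end

context padic_q
begin

text \<open>Resolves the definite description: the generating function exhibits one solution and
  \<open>egf_coeff_unique\<close> excludes any other.\<close>

lemma degenerate_carlitz_bernoulli_eq:
  assumes "vabs x \<le> 1" "lam \<noteq> 0"
  shows "degenerate_carlitz_bernoulli p q r m x lam =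
    (\<Sum>k\<le>m. carlitz_bernoulli p q r k x * coeff (degen_ffact lam m) k)"
proof -
  have "(THE b. \<forall>t. vabs (lam * t) < radius \<and> vabs t < radius \<longrightarrow>
        (\<lambda>m. b m * t ^ m / fact m) sums
          multi_q_integral p q r (\<lambda>ys. degenerate_exp lam t (qnum q (sum_list ys + x)))) =
      (\<lambda>m. \<Sum>k\<le>m. carlitz_bernoulli p q r k x * coeff (degen_ffact lam m) k)" (is "The ?P = ?b")
  proof (rule the_equality)
    show "?P ?b"
      using degenerate_generating_function[OF assms] by blast
    then show "b = ?b" if "?P b" for b
      using that by (intro egf_coeff_unique) blast+
  qed
  then show ?thesis
    unfolding degenerate_carlitz_bernoulli_def by (rule fun_cong)
qed

end

theorem theorem7:
  fixes p r n :: nat and q lam x :: "'a::complete_valued_field"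
  assumes "prime p"
    and "is_padic_complex TYPE('a) p"
    and "vabs (q - 1) < real p powr (- 1 / (real p - 1))"
    and "lam \<noteq> 0"
    and "x \<in> padic_ints"
  shows "carlitz_bernoulli p q r n x =
    (\<Sum>m=0..n. lam ^ (n - m) * of_nat (Stirling n m) * degenerate_carlitz_bernoulli p q r m x lam)"
proof -
  interpret padic_q p "TYPE('a)" q
    using assms by unfold_locales (auto simp: is_padic_complex_def conv_radius_exp_def)
  have x: "vabs x \<le> 1"
    using assms(5) by (simp add: padic_ints_def)
  let ?\<beta> = "\<lambda>k. carlitz_bernoulli p q r k x"
  let ?c = "\<lambda>m. lam ^ (n - m) * of_nat (Stirling n m)"
  have "?\<beta> n = (\<Sum>k\<le>n. ?\<beta> k * coeff (monom 1 n) k)"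
    by (simp add: coeff_monom mult_delta_right)
  also have "\<dots> = (\<Sum>k\<le>n. ?\<beta> k * (\<Sum>m\<le>n. ?c m * coeff (degen_ffact lam m) k))"
    by (subst monom_eq_sum_degen_ffact[of n lam]) (simp add: coeff_sum)
  also have "\<dots> = (\<Sum>m\<le>n. ?c m * (\<Sum>k\<le>n. ?\<beta> k * coeff (degen_ffact lam m) k))"
    unfolding sum_distrib_left by (subst sum.swap) (simp add: mult_ac)
  also have "\<dots> = (\<Sum>m\<le>n. ?c m * degenerate_carlitz_bernoulli p q r m x lam)"
  proof (intro sum.cong refl arg_cong2[where f = times])
    fix m assume "m \<in> {..n}"
    \<comment> \<open>For m < k \<le> n the coefficient is 0 by degree, so the range shrinks to k
      \<le> m.\<close>
    then show "(\<Sum>k\<le>n. ?\<beta> k * coeff (degen_ffact lam m) k) = degenerate_carlitz_bernoulli p q r m x lam"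
      unfolding degenerate_carlitz_bernoulli_eq[OF x assms(4)]
      by (intro sum.mono_neutral_right) (auto simp: coeff_degen_ffact_eq_0)
  qed
  finally show ?thesis
    by (simp only: atLeast0AtMost)
qed

end
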